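(* For every constant $d$, the problem $d$-Hitting Set($k$) admits a logspace kernelization that runs in time $O(|\mathcal{F}|^{d+2})$ and returns an equivalent instance with at most $(k+1)^d$ sets.
   Context: $d$-Hitting Set($k$): given a finite set $U$, a family $\mathcal{F}$ of subsets of $U$ each of size at most $d$, and $k \in \mathbb{N}$ (the parameter), decide whether there is a set $S \subseteq U$ with $|S| \leq k$ such that $S \cap F \neq \emptyset$ for every $F \in \mathcal{F}$. A kernelization for a parameterized problem is an algorithm that, given an instance $(x,k)$, computes in time polynomial in $|x|+k$ an instance $(x',k')$ with $|x'|+k' \leq g(k)$ for some computable $g$ such that $(x,k)$ is a yes-instance iff $(x',k')$ is a yes-instance (an equivalent instance). A logspace kernelization is a kernelization that uses only logarithmic working space (read-only input, write-only output). *)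

theory Defs
  imports Complex_Main "HOL-Library.Log_Nat"
begin

text \<open>
  The machine model is a random access machine with a read-only random access input, a write-only
  output stream, and a sparse work memory; it has no multiplication. Every instruction and every
  test costs one time unit. Working space is measured in bits, so under a bound
  \<open>O(log n)\<close> every machine word has only \<open>O(log n)\<close> bits and unit cost is the usual
  word-RAM cost.
\<close>

type_synonym mem = "nat \<Rightarrow> nat"

datatype instr =
    Const nat nat      \<comment> \<open>\<open>m[r] := n\<close>\<close>
  | Add nat nat nat    \<comment> \<open>\<open>m[r] := m[p] + m[q]\<close>\<close>
  | Sub nat nat nat    \<comment> \<open>\<open>m[r] := m[p] - m[q]\<close>, truncated at \<open>0\<close>\<close>
  | Load nat nat       \<comment> \<open>\<open>m[r] := m[m[p]]\<close>\<close>
  | Store nat nat      \<comment> \<open>\<open>m[m[r]] := m[p]\<close>\<close>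
  | InLen nat          \<comment> \<open>\<open>m[r] :=\<close> number of input words\<close>
  | Read nat nat       \<comment> \<open>\<open>m[r] := input[m[p]]\<close>, and \<open>0\<close> beyond the end of the input\<close>
  | Write nat          \<comment> \<open>append \<open>m[r]\<close> to the output\<close>

fun effect :: "nat list \<Rightarrow> instr \<Rightarrow> mem \<Rightarrow> mem" where
  "effect w (Const r n) m = m(r := n)"
| "effect w (Add r p q) m = m(r := m p + m q)"
| "effect w (Sub r p q) m = m(r := m p - m q)"
| "effect w (Load r p) m = m(r := m (m p))"
| "effect w (Store r p) m = m(m r := m p)"
| "effect w (InLen r) m = m(r := length w)"
| "effect w (Read r p) m = m(r := (if m p < length w then w ! m p else 0))"
| "effect w (Write r) m = m"

fun emitted :: "instr \<Rightarrow> mem \<Rightarrow> nat list" where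
  "emitted (Write r) m = [m r]"
| "emitted _ m = []"

datatype prog =
    Instr instr
  | Seq prog prog
  | IfNZ nat prog prog   \<comment> \<open>test whether \<open>m[r]\<close> is nonzero\<close>
  | WhileNZ nat prog

text \<open>
  Work memory is charged for the address and the content of every nonzero cell. All cells are
  initially zero, so only finitely many cells are ever nonzero. Input and output are not charged.
\<close>

definition space :: "mem \<Rightarrow> nat" where
  "space m = (\<Sum>a | m a \<noteq> 0. nat (bitlen (int a)) + nat (bitlen (int (m a))))"

text \<open>
  \<open>exec w P m t s out m'\<close>: on input \<open>w\<close> and started in memory \<open>m\<close>, the program \<open>P\<close> halts after
  exactly \<open>t\<close> steps in memory \<open>m'\<close>, having appended \<open>out\<close> to the output, and \<open>s\<close> is the maximal
  space of a memory reached on the way.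
\<close>

inductive exec ::
    "nat list \<Rightarrow> prog \<Rightarrow> mem \<Rightarrow> nat \<Rightarrow> nat \<Rightarrow> nat list \<Rightarrow> mem \<Rightarrow> bool"
  for w :: "nat list" where
  Instr: "exec w (Instr i) m 1 (max (space m) (space (effect w i m))) (emitted i m) (effect w i m)"
| Seq: "exec w P m t s out m' \<Longrightarrow> exec w Q m' t' s' out' m'' \<Longrightarrow>
    exec w (Seq P Q) m (t + t') (max s s') (out @ out') m''"
| IfTrue: "m r \<noteq> 0 \<Longrightarrow> exec w P m t s out m' \<Longrightarrow> exec w (IfNZ r P Q) m (t + 1) s out m'"
| IfFalse: "m r = 0 \<Longrightarrow> exec w Q m t s out m' \<Longrightarrow> exec w (IfNZ r P Q) m (t + 1) s out m'"
| WhileTrue: "m r \<noteq> 0 \<Longrightarrow> exec w P m t s out m' \<Longrightarrow> exec w (WhileNZ r P) m' t' s' out' m'' \<Longrightarrow>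
    exec w (WhileNZ r P) m (t + t' + 1) (max s s') (out @ out') m''"
| WhileFalse: "m r = 0 \<Longrightarrow> exec w (WhileNZ r P) m 1 (space m) [] m"

lemma exec_deterministic:
  assumes "exec w P m t s out m'" "exec w P m u v out' m''"
  shows "u = t \<and> v = s \<and> out' = out \<and> m'' = m'"
  using assms
proof (induction arbitrary: u v out' m'')
  case (Instr i m)
  from Instr.prems show ?case by cases auto
next
  case (Seq P m t s out m' Q t' s' out1 m1)
  from Seq.prems show ?case
  proof cases
    case A: (Seq t2 s2 out2 m2 t3 s3 out3)
    note B = Seq.IH(1)[OF A(4)]
    have "exec w Q m' t3 s3 out3 m''" using A(5) B by simp
    note C = Seq.IH(2)[OF this]
    show ?thesis unfolding A(1-3) using B C by simp
  qed
next
  case (IfTrue m r P t s out m' Q)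
  from IfTrue.prems show ?case
  proof cases
    case A: (IfTrue t2)
    show ?thesis unfolding A(1) using IfTrue.IH[OF A(3)] by simp
  qed (use IfTrue.hyps(1) in simp)
next
  case (IfFalse m r Q t s out m' P)
  from IfFalse.prems show ?case
  proof cases
    case A: (IfFalse t2)
    show ?thesis unfolding A(1) using IfFalse.IH[OF A(3)] by simp
  qed (use IfFalse.hyps(1) in simp)
next
  case (WhileTrue m r P t s out m' t' s' out1 m1)
  from WhileTrue.prems show ?case
  proof cases
    case A: (WhileTrue t2 s2 out2 m2 t3 s3 out3)
    note B = WhileTrue.IH(1)[OF A(5)]
    have "exec w (WhileNZ r P) m' t3 s3 out3 m''" using A(6) B by simp
    note C = WhileTrue.IH(2)[OF this]
    show ?thesis unfolding A(1-3) using B C by simp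
  qed (use WhileTrue.hyps(1) in simp)
next
  case (WhileFalse m r P)
  from WhileFalse.prems show ?case
  proof cases
    case A: WhileFalse
    then show ?thesis by simp
  qed (use WhileFalse.hyps in simp)
qed

definition runs :: "prog \<Rightarrow> nat list \<Rightarrow> nat \<Rightarrow> nat \<Rightarrow> nat list \<Rightarrow> bool" where
  "runs P w t s out \<longleftrightarrow> (\<exists>m. exec w P (\<lambda>_. 0) t s out m)"

definition computable :: "(nat \<Rightarrow> nat) \<Rightarrow> bool" where
  "computable g \<longleftrightarrow> (\<exists>P. \<forall>k. \<exists>t s. runs P [k] t s [g k])"

text \<open>
  An instance \<open>(x, k)\<close> of a parameterized problem is an abstract object of type \<open>'i\<close> with
  \<open>|x|\<close> given by \<open>input_size\<close> and \<open>k\<close> by \<open>parameter\<close>. Encoding is a relation, since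
  one mathematical instance may be written down in several ways; algorithms must cope with each.
\<close>

record 'i parameterized_problem =
  instances :: "'i set"
  yes_instances :: "'i set"
  input_size :: "'i \<Rightarrow> nat"
  parameter :: "'i \<Rightarrow> nat"
  encodes :: "nat list \<Rightarrow> 'i \<Rightarrow> bool"

definition kernelization :: "'i parameterized_problem \<Rightarrow> prog \<Rightarrow> bool" where
  "kernelization Q P \<longleftrightarrow>
    (\<exists>(c::nat) e g. computable g \<and>
      (\<forall>I \<in> instances Q. \<forall>w. encodes Q w I \<longrightarrow>
        (\<exists>t s out. runs P w t s out \<and>
          t \<le> c * (input_size Q I + parameter Q I) ^ e + c \<and>
          (\<exists>I' \<in> instances Q. encodes Q out I' \<and>
            (I \<in> yes_instances Q \<longleftrightarrow> I' \<in> yes_instances Q) \<and>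
            input_size Q I' + parameter Q I' \<le> g (parameter Q I)))))"

definition logspace_kernelization :: "'i parameterized_problem \<Rightarrow> prog \<Rightarrow> bool" where
  "logspace_kernelization Q P \<longleftrightarrow> kernelization Q P \<and>
    (\<exists>c::real. \<forall>I \<in> instances Q. \<forall>w t s out. encodes Q w I \<longrightarrow> runs P w t s out \<longrightarrow>
      real s \<le> c * log 2 (real (input_size Q I + parameter Q I + 2)))"

type_synonym hs_instance = "nat set \<times> nat set set \<times> nat"

definition has_hitting_set :: "hs_instance \<Rightarrow> bool" where
  "has_hitting_set = (\<lambda>(U, F, k). \<exists>S \<subseteq> U. card S \<le> k \<and> (\<forall>X \<in> F. S \<inter> X \<noteq> {}))"

text \<open>
  The elements of \<open>U\<close> are numbered \<open>0, ..., |U| - 1\<close> by an arbitrary enumeration \<open>us\<close>, and each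
  set of the family is written, without repetitions, as its size followed by the numbers of its
  elements. Each set of the family is listed exactly once, in arbitrary order.
\<close>

definition hs_encodes :: "nat list \<Rightarrow> hs_instance \<Rightarrow> bool" where
  "hs_encodes w = (\<lambda>(U, F, k). \<exists>us Fs.
     distinct us \<and> set us = U \<and>
     (\<forall>X \<in> set Fs. distinct X \<and> set X \<subseteq> {..<length us}) \<and>
     distinct (map set Fs) \<and> F = (\<lambda>X. (!) us ` set X) ` set Fs \<and>
     w = k # length us # length Fs # concat (map (\<lambda>X. length X # X) Fs))"

definition hitting_set :: "nat \<Rightarrow> hs_instance parameterized_problem" where
  "hitting_set d = \<lparr>
     instances = {(U, F, k). finite U \<and> (\<forall>X \<in> F. X \<subseteq> U \<and> card X \<le> d)},
     yes_instances = {I. has_hitting_set I},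
     input_size = (\<lambda>(U, F, k). card U + card F + (\<Sum>X \<in> F. card X)),
     parameter = (\<lambda>(U, F, k). k),
     encodes = hs_encodes\<rparr>"

end

theory Submission
  imports Defs
begin

text \<open>
  The kernel is a subfamily of the input, obtained by \<open>d\<close> rounds of filtering. Round \<open>l\<close> discards a
  set \<open>X\<close> if some \<open>C \<subseteq> X\<close> with \<open>card C = d - l\<close> lies in at least \<open>q ^ l\<close> earlier sets that survived the
  previous rounds, where \<open>q = k + 1\<close>. After round \<open>l\<close> every \<open>C\<close> of size \<open>d - l\<close> lies in at most \<open>q ^ l\<close> survivors,
  so \<open>C = {}\<close> gives at most \<open>q ^ d\<close> sets at the end. Discarding is safe: if at most \<open>k\<close> elements hit
  \<open>q ^ l\<close> survivors containing \<open>C\<close> but avoid \<open>C\<close>, then one of them, added to \<open>C\<close>, has more than \<open>q ^ (l - 1)\<close> survivors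
  above it, against the bound of the previous round.

  Survival is recomputed on demand by \<open>d\<close> nested scans of the input, so only constantly many
  counters and pointers are stored. Writing an element scans the survivors once more to find
  its first occurrence, whose position is the new name of the element; together with the loop over the
  sets to be written this gives \<open>d + 2\<close> nested loops.
\<close>

section \<open>The filtered family\<close>

text \<open>Logarithmic space rules out storing which sets have been discarded. A greedy rule that
  compares a set with those kept so far in the same round would recurse along the family. Comparing
  with the earlier survivors of the previous round makes the recursion descend in the round number
  only, so its depth is the constant \<open>d\<close>. The thresholds are powers of
  \<open>q = k + 1\<close> because \<open>k * q ^ (l - 1) < q ^ l\<close>: distributed over at most
  \<open>k\<close> hitting elements, \<open>q ^ l\<close> sets must overfill one of them. Renaming
  is forced by the notion of a kernel: the universe counts towards the size, and as a table of new
  names would not fit into memory, a name has to be something that a rescan recomputes. Choices that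
  depend on \<open>d\<close> only, such as the subsets of a set, are unrolled into the program text;
  loops remain for the sets of the family and for counting up to \<open>q\<close>.\<close>

definition hittable :: "nat \<Rightarrow> nat list list \<Rightarrow> bool" where
  "hittable k Fs \<longleftrightarrow> (\<exists>S. finite S \<and> card S \<le> k \<and> (\<forall>X \<in> set Fs. S \<inter> set X \<noteq> {}))"

lemma hittable_map:
  assumes "hittable k Fs"
  shows "hittable k (map (map f) Fs)"
proof -
  obtain S where S: "finite S" "card S \<le> k" "\<forall>X \<in> set Fs. S \<inter> set X \<noteq> {}"
    using assms unfolding hittable_def by blast
  have "card (f ` S) \<le> k" using S card_image_le le_trans by blast
  moreover have "f ` S \<inter> set X \<noteq> {}" if X: "X \<in> set (map (map f) Fs)" for X
  proof -
    obtain Y where "Y \<in> set Fs" "X = map f Y" using X by auto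
    then show ?thesis using S(3) by fastforce
  qed
  ultimately show ?thesis unfolding hittable_def using S(1) by blast
qed

lemma hittable_map_inj:
  assumes "inj_on f (\<Union>X \<in> set Fs. set X)"
  shows "hittable k (map (map f) Fs) \<longleftrightarrow> hittable k Fs"
proof
  let ?g = "inv_into (\<Union>X \<in> set Fs. set X) f"
  have "map (map ?g) (map (map f) Fs) = Fs"
    using assms by (auto simp: comp_def intro!: map_idI inv_into_f_f)
  then show "hittable k (map (map f) Fs) \<Longrightarrow> hittable k Fs" by (metis hittable_map)
qed (rule hittable_map)

text \<open>Solutions and sets of positions translate into each other through \<open>(!) us\<close>.
  Injectivity of the enumeration keeps the size; positions beyond \<open>length us\<close> can be
  cut off, as no set contains them.\<close>

lemma has_hitting_set_iff_hittable:
  assumes "distinct us" "set us = U" "\<forall>X \<in> set Fs. set X \<subseteq> {..<length us}"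
    and F: "F = (\<lambda>X. (!) us ` set X) ` set Fs"
  shows "has_hitting_set (U, F, k) \<longleftrightarrow> hittable k Fs"
proof
  assume "has_hitting_set (U, F, k)"
  then obtain S where S: "S \<subseteq> U" "card S \<le> k" "\<forall>X \<in> F. S \<inter> X \<noteq> {}"
    unfolding has_hitting_set_def by auto
  let ?T = "{i. i < length us \<and> us ! i \<in> S}"
  have "(!) us ` ?T \<subseteq> S" by auto
  moreover have "inj_on ((!) us) ?T" using assms(1) by (auto simp: inj_on_def nth_eq_iff_index_eq)
  moreover have "finite S" using S(1) assms(2) finite_subset by blast
  ultimately have "card ?T \<le> card S" by (metis card_inj_on_le)
  moreover have "?T \<inter> set X \<noteq> {}" if X: "X \<in> set Fs" for X
  proof -
    have "S \<inter> (!) us ` set X \<noteq> {}" using S(3) X F by blast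
    then show ?thesis using assms(3) X by fastforce
  qed
  ultimately show "hittable k Fs" unfolding hittable_def using S(2)
    by (intro exI[of _ ?T]) auto
next
  assume "hittable k Fs"
  then obtain T where T: "finite T" "card T \<le> k" "\<forall>X \<in> set Fs. T \<inter> set X \<noteq> {}"
    unfolding hittable_def by blast
  let ?S = "(!) us ` (T \<inter> {..<length us})"
  have "?S \<subseteq> U" using assms(2) by auto
  moreover have "card ?S \<le> k"
    using T card_image_le[of "T \<inter> {..<length us}" "(!) us"] card_mono[of T "T \<inter> {..<length us}"]
    by force
  moreover have "?S \<inter> Y \<noteq> {}" if Y: "Y \<in> F" for Y
  proof -
    obtain X where X: "X \<in> set Fs" "Y = (!) us ` set X" using Y F by auto
    then obtain x where "x \<in> T" "x \<in> set X" using T(3) by blast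
    then show ?thesis using assms(3) X by blast
  qed
  ultimately show "has_hitting_set (U, F, k)" unfolding has_hitting_set_def prod.case
    by (intro exI[of _ ?S]) blast
qed

text \<open>A set with fewer than \<open>d - Suc l\<close> elements contains no candidate
  \<open>C\<close> and passes the round; short sets are filtered only later, when \<open>C\<close>
  is small enough to fit.\<close>

fun survives :: "nat \<Rightarrow> nat \<Rightarrow> nat list list \<Rightarrow> nat \<Rightarrow> nat \<Rightarrow> bool" where
  "survives d q Fs 0 i = True"
| "survives d q Fs (Suc l) i \<longleftrightarrow> survives d q Fs l i \<and>
    (\<forall>C \<subseteq> set (Fs ! i). card C = d - Suc l \<longrightarrow>
      card {i'. i' < i \<and> survives d q Fs l i' \<and> C \<subseteq> set (Fs ! i')} < q ^ Suc l)"

text \<open>In round \<open>0\<close> a superset of \<open>C\<close> with at most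
  \<open>d = card C\<close> elements equals \<open>C\<close>, and no set is listed twice. Later,
  take the last survivor above \<open>C\<close>: fewer than \<open>q ^ l\<close> earlier survivors
  of the previous round contain \<open>C\<close>, and all other members of the count are among
  these.\<close>

lemma survivor_degree:
  assumes "distinct (map set Fs)" "\<forall>X \<in> set Fs. length X \<le> d" "0 < q" "card C = d - l" "finite C"
  shows "card {i. i < length Fs \<and> survives d q Fs l i \<and> C \<subseteq> set (Fs ! i)} \<le> q ^ l"
proof (cases l)
  case 0
  have eq: "set (Fs ! i) = C" if "i < length Fs" "C \<subseteq> set (Fs ! i)" for i
  proof -
    have "card (set (Fs ! i)) \<le> card C"
      using assms that 0 card_length[of "Fs ! i"] by (force dest: nth_mem)
    then show ?thesis using that card_seteq by blast
  qed
  have "is_singleton A \<or> A = {}"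
    if "A = {i. i < length Fs \<and> C \<subseteq> set (Fs ! i)}" for A
  proof (cases "A = {}")
    case False
    then obtain i where i: "i \<in> A" by blast
    have "j = i" if "j \<in> A" for j
    proof -
      have "map set Fs ! i = map set Fs ! j" "i < length (map set Fs)" "j < length (map set Fs)"
        using i that eq \<open>A = _\<close> by auto
      then show ?thesis using assms(1) nth_eq_iff_index_eq by metis
    qed
    then show ?thesis using i by (auto intro: is_singletonI')
  qed simp
  from this[OF refl] have "card {i. i < length Fs \<and> C \<subseteq> set (Fs ! i)} \<le> 1"
    by (metis card.empty is_singleton_altdef le_refl zero_le)
  then show ?thesis using 0 by simp
next
  case (Suc l')
  let ?D = "{i. i < length Fs \<and> survives d q Fs l i \<and> C \<subseteq> set (Fs ! i)}"
  have fin: "finite ?D" by simp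
  show ?thesis
  proof (cases "?D = {}")
    case False
    define i where "i = Max ?D"
    have i: "i \<in> ?D" unfolding i_def using fin False Max_in by blast
    let ?E = "{i'. i' < i \<and> survives d q Fs l' i' \<and> C \<subseteq> set (Fs ! i')}"
    have sub: "?D - {i} \<subseteq> ?E"
    proof
      fix j assume j: "j \<in> ?D - {i}"
      then have "j \<le> i" unfolding i_def using fin Max_ge by blast
      then show "j \<in> ?E" using j Suc by auto
    qed
    have "card (?D - {i}) \<le> card ?E" by (rule card_mono[OF _ sub]) simp
    also have "\<dots> < q ^ l" using i assms(4) Suc by auto
    finally show ?thesis using i fin by (simp add: card_Diff_singleton_if split: if_splits)
  qed (metis card.empty le0)
qed

text \<open>Either the threshold base exceeds \<open>k\<close>, or it exceeds the number of sets and then nothing is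
  ever discarded. The second case makes it harmless to cap \<open>k\<close> at the number of sets.\<close>

lemma hits_survivors_step:
  assumes "distinct (map set Fs)" "\<forall>X \<in> set Fs. length X \<le> d"
    and q: "k < q \<or> length Fs < q" and l: "Suc l \<le> d"
    and S: "finite S" "card S \<le> k"
    and hit: "\<And>i. i < length Fs \<Longrightarrow> survives d q Fs (Suc l) i \<Longrightarrow> S \<inter> set (Fs ! i) \<noteq> {}"
  shows "i < length Fs \<Longrightarrow> survives d q Fs l i \<Longrightarrow> S \<inter> set (Fs ! i) \<noteq> {}"
proof (induction i rule: less_induct)
  case (less i)
  show ?case
  proof (cases "survives d q Fs (Suc l) i")
    case True
    then show ?thesis using hit less.prems by blast
  next
    case False
    then obtain C where C: "C \<subseteq> set (Fs ! i)" "card C = d - Suc l"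
      "q ^ Suc l \<le> card {i'. i' < i \<and> survives d q Fs l i' \<and> C \<subseteq> set (Fs ! i')}"
      using less.prems by (auto simp: not_less)
    let ?D = "{i'. i' < i \<and> survives d q Fs l i' \<and> C \<subseteq> set (Fs ! i')}"
    have q0: "0 < q" using q by auto
    have finC: "finite C" using C(1) finite_subset by blast
    have "card ?D \<le> card {..<i}" by (rule card_mono) auto
    moreover have "q \<le> q ^ Suc l" using q0 by simp
    \<comment> \<open>A discarded \<open>i\<close> has at least \<open>q ^ Suc l\<close>, hence at
      least \<open>q\<close>, predecessors; so only the alternative \<open>k < q\<close> is
      left.\<close>
    ultimately have "\<not> length Fs < q"
      using C(3) less.prems(1) unfolding card_lessThan by linarith
    then have "k < q" using q by blast
    have "S \<inter> C \<noteq> {}"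
    proof
      assume SC: "S \<inter> C = {}"
      \<comment> \<open>By the induction hypothesis \<open>S\<close> hits every set counted in
        \<open>?D\<close>. As \<open>S\<close> misses \<open>C\<close>, the hitting element
        \<open>v\<close> lies outside \<open>C\<close>, and \<open>insert v C\<close> has exactly
        the size whose degree round \<open>l\<close> bounds by \<open>q ^ l\<close>.\<close>
      have "?D \<subseteq> (\<Union>v \<in> S. {i'. i' < length Fs \<and> survives d q Fs l i' \<and> insert v C \<subseteq> set (Fs ! i')})"
        using less.IH less.prems(1) by fastforce
      then have "card ?D \<le> card (\<Union>v \<in> S.
          {i'. i' < length Fs \<and> survives d q Fs l i' \<and> insert v C \<subseteq> set (Fs ! i')})"
        by (rule card_mono[rotated]) (use S in auto)
      also have "\<dots> \<le> (\<Sum>v \<in> S.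
          card {i'. i' < length Fs \<and> survives d q Fs l i' \<and> insert v C \<subseteq> set (Fs ! i')})"
        using S(1) card_UN_le by blast
      also have "\<dots> \<le> (\<Sum>v \<in> S. q ^ l)"
      proof (rule sum_mono)
        fix v assume "v \<in> S"
        then have "card (insert v C) = d - l" using SC C(2) l finC by (auto simp: card_insert_if)
        then show "card {i'. i' < length Fs \<and> survives d q Fs l i' \<and> insert v C \<subseteq> set (Fs ! i')} \<le> q ^ l"
          using survivor_degree[OF assms(1,2) q0] finC by blast
      qed
      also have "\<dots> \<le> k * q ^ l" using S(2) by simp
      also have "\<dots> < q ^ Suc l" using \<open>k < q\<close> q0 by simp
      finally show False using C(3) by simp
    qed
    then show ?thesis using C(1) by blast
  qed
qed

definition survivors :: "nat \<Rightarrow> nat \<Rightarrow> nat list list \<Rightarrow> nat list list" where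
  "survivors d q Fs = map ((!) Fs) (filter (survives d q Fs d) [0..<length Fs])"

lemma set_survivors: "set (survivors d q Fs) = {Fs ! i | i. i < length Fs \<and> survives d q Fs d i}"
  unfolding survivors_def by auto

lemma set_survivors_subset: "set (survivors d q Fs) \<subseteq> set Fs"
  unfolding set_survivors by auto

lemma distinct_survivors: "distinct (map set Fs) \<Longrightarrow> distinct (map set (survivors d q Fs))"
  unfolding survivors_def
  by (auto simp: distinct_map inj_on_def nth_eq_iff_index_eq) (metis nth_eq_iff_index_eq nth_mem)

lemma length_survivors:
  assumes "distinct (map set Fs)" "\<forall>X \<in> set Fs. length X \<le> d" "0 < q"
  shows "length (survivors d q Fs) \<le> q ^ d"
proof -
  have "length (survivors d q Fs) = card {i. i < length Fs \<and> survives d q Fs d i}"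
    unfolding survivors_def by (simp add: length_filter_conv_card cong: conj_cong)
  then show ?thesis using survivor_degree[OF assms, of "{}" d] by simp
qed

text \<open>One and the same \<open>S\<close> serves all rounds: what hits the survivors of round
  \<open>l + 1\<close> hits those of round \<open>l\<close>, and this descends from \<open>d\<close>
  to \<open>0\<close>, where everything survives.\<close>

lemma hittable_survivors:
  assumes "distinct (map set Fs)" "\<forall>X \<in> set Fs. length X \<le> d"
    and "k < q \<or> length Fs < q"
  shows "hittable k (survivors d q Fs) \<longleftrightarrow> hittable k Fs"
proof
  assume "hittable k (survivors d q Fs)"
  then obtain S where S: "finite S" "card S \<le> k" "\<forall>X \<in> set (survivors d q Fs). S \<inter> set X \<noteq> {}"
    unfolding hittable_def by blast
  have "\<forall>i < length Fs. survives d q Fs l i \<longrightarrow> S \<inter> set (Fs ! i) \<noteq> {}" if "l \<le> d" for l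
    using that
  proof (induction rule: inc_induct)
    case base
    then show ?case using S(3) unfolding set_survivors by blast
  next
    case (step l)
    then show ?case using hits_survivors_step[OF assms _ S(1,2)] by (meson Suc_leI)
  qed
  from this[of 0] have "\<forall>X \<in> set Fs. S \<inter> set X \<noteq> {}" by (auto simp: in_set_conv_nth)
  then show "hittable k Fs" unfolding hittable_def using S(1,2) by metis
next
  assume "hittable k Fs"
  then show "hittable k (survivors d q Fs)"
    unfolding hittable_def using set_survivors_subset[of d q Fs] by (meson subsetD)
qed

text \<open>An element is renamed to the index of its first occurrence when all sets are padded to
  length \<open>d\<close> and concatenated.\<close>

definition pad :: "nat \<Rightarrow> nat list \<Rightarrow> nat option list" where
  "pad d X = map Some X @ replicate (d - length X) None"

definition first_index :: "'a \<Rightarrow> 'a list \<Rightarrow> nat" where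
  "first_index x xs = length (takeWhile (\<lambda>y. y \<noteq> x) xs)"

definition label :: "nat \<Rightarrow> nat list list \<Rightarrow> nat \<Rightarrow> nat" where
  "label d Fs x = first_index (Some x) (concat (map (pad d) Fs))"

lemma length_pad: "length X \<le> d \<Longrightarrow> length (pad d X) = d"
  by (simp add: pad_def)

lemma nth_pad: "j < d \<Longrightarrow> pad d X ! j = (if j < length X then Some (X ! j) else None)"
  by (auto simp: pad_def nth_append)

lemma Some_in_pad: "Some x \<in> set (pad d X) \<longleftrightarrow> x \<in> set X"
  by (auto simp: pad_def)

lemma first_index_nth: "x \<in> set xs \<Longrightarrow> first_index x xs < length xs \<and> xs ! first_index x xs = x"
  unfolding first_index_def by (induction xs) auto

text \<open>The recurrence that \<open>find_label\<close> computes: until the element has been met,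
  the index equals the number of entries scanned; after that it is frozen.\<close>

lemma first_index_snoc:
  "first_index x (xs @ [y]) = (if x \<in> set xs \<or> y = x then first_index x xs else Suc (first_index x xs))"
  unfolding first_index_def by (induction xs) auto

lemma length_concat_pad:
  "\<forall>X \<in> set Fs. length X \<le> d \<Longrightarrow> length (concat (map (pad d) Fs)) = d * length Fs"
  by (induction Fs) (auto simp: length_pad)

text \<open>Padding gives each survivor exactly \<open>d\<close> slots, so the number of survivors
  alone fixes a range for all labels. The program can announce this range as the universe without
  counting distinct elements.\<close>

lemma label_less:
  assumes "\<forall>X \<in> set Fs. length X \<le> d" "X \<in> set Fs" "x \<in> set X"
  shows "label d Fs x < d * length Fs"
proof -
  have "Some x \<in> set (concat (map (pad d) Fs))" using assms by (auto simp: Some_in_pad)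
  then show ?thesis unfolding label_def
    using first_index_nth length_concat_pad[OF assms(1)] by metis
qed

lemma inj_on_label: "inj_on (label d Fs) (\<Union>X \<in> set Fs. set X)"
proof (rule inj_onI)
  fix x y
  assume "x \<in> (\<Union>X \<in> set Fs. set X)" "y \<in> (\<Union>X \<in> set Fs. set X)" and eq: "label d Fs x = label d Fs y"
  then have "Some x \<in> set (concat (map (pad d) Fs))" "Some y \<in> set (concat (map (pad d) Fs))"
    by (auto simp: Some_in_pad)
  from this[THEN first_index_nth] eq show "x = y" unfolding label_def by (metis option.inject)
qed

definition kernel_family :: "nat \<Rightarrow> nat \<Rightarrow> nat list list \<Rightarrow> nat list list" where
  "kernel_family d q Fs = map (map (label d (survivors d q Fs))) (survivors d q Fs)"

definition encoding :: "nat \<Rightarrow> nat \<Rightarrow> nat list list \<Rightarrow> nat list" where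
  "encoding k u Fs = k # u # length Fs # concat (map (\<lambda>X. length X # X) Fs)"

lemma kernel_family_props:
  assumes "distinct (map set Fs)" "\<forall>X \<in> set Fs. distinct X \<and> length X \<le> d"
    and "k < q \<or> length Fs < q" and m: "m = length (survivors d q Fs)"
  shows "length (kernel_family d q Fs) = m" "m \<le> q ^ d"
    and "\<forall>X \<in> set (kernel_family d q Fs). distinct X \<and> length X \<le> d \<and> set X \<subseteq> {..<d * m}"
    and "distinct (map set (kernel_family d q Fs))"
    and "hittable k (kernel_family d q Fs) \<longleftrightarrow> hittable k Fs"
proof -
  let ?K = "survivors d q Fs"
  have len: "\<forall>X \<in> set ?K. length X \<le> d" and dist: "\<forall>X \<in> set ?K. distinct X"
    using assms(2) set_survivors_subset by blast+
  note inj = inj_on_label[of d ?K]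
  show "length (kernel_family d q Fs) = m" by (simp add: kernel_family_def m)
  show "m \<le> q ^ d" using length_survivors assms by auto
  show "\<forall>X \<in> set (kernel_family d q Fs). distinct X \<and> length X \<le> d \<and> set X \<subseteq> {..<d * m}"
  proof
    fix Y assume "Y \<in> set (kernel_family d q Fs)"
    then obtain X where X: "X \<in> set ?K" "Y = map (label d ?K) X"
      by (auto simp: kernel_family_def)
    moreover have "inj_on (label d ?K) (set X)" by (rule inj_on_subset[OF inj]) (use X in blast)
    moreover have "set Y \<subseteq> {..<d * m}" using X label_less[OF len] m by auto
    ultimately show "distinct Y \<and> length Y \<le> d \<and> set Y \<subseteq> {..<d * m}"
      using len dist by (simp add: distinct_map)
  qed
  have "distinct (map ((`) (label d ?K)) (map set ?K))"
    unfolding distinct_map[of "(`) (label d ?K)"]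
    using distinct_survivors[OF assms(1), of d q] inj_on_image[of "label d ?K" "set (map set ?K)"] inj
    by simp
  then show "distinct (map set (kernel_family d q Fs))"
    by (simp add: kernel_family_def comp_def)
  show "hittable k (kernel_family d q Fs) \<longleftrightarrow> hittable k Fs"
    unfolding kernel_family_def hittable_map_inj[OF inj]
    using hittable_survivors assms by blast
qed

section \<open>Time and space of programs\<close>

text \<open>\<open>N\<close> is a common cap on the iterations of every loop at each entry; the
  proof rule for loops verifies it. An iteration pays its body and one test, and the final
  \<open>1\<close> is the failing test.\<close>

fun cost :: "nat \<Rightarrow> prog \<Rightarrow> nat" where
  "cost N (Instr i) = 1"
| "cost N (Seq P Q) = cost N P + cost N Q"
| "cost N (IfNZ r P Q) = max (cost N P) (cost N Q) + 1"
| "cost N (WhileNZ r P) = N * (cost N P + 1) + 1"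

fun loop_depth :: "prog \<Rightarrow> nat" where
  "loop_depth (Instr i) = 0"
| "loop_depth (Seq P Q) = max (loop_depth P) (loop_depth Q)"
| "loop_depth (IfNZ r P Q) = max (loop_depth P) (loop_depth Q)"
| "loop_depth (WhileNZ r P) = Suc (loop_depth P)"

text \<open>Only nesting multiplies: each loop level costs a factor \<open>N + 1\<close>, whereas
  sequencing and branching add up to a constant given by the program text.\<close>

lemma cost_le: "loop_depth P \<le> e \<Longrightarrow> cost N P \<le> (size P + 1) * (N + 1) ^ e"
proof (induction P arbitrary: e)
  case (Seq P Q)
  then have "cost N P \<le> (size P + 1) * (N + 1) ^ e" "cost N Q \<le> (size Q + 1) * (N + 1) ^ e" by auto
  then show ?case by (simp add: algebra_simps)
next
  case (IfNZ r P Q)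
  let ?E = "(N + 1) ^ e"
  have "cost N P \<le> (size P + 1) * ?E" "cost N Q \<le> (size Q + 1) * ?E" using IfNZ by auto
  moreover have "(size P + 1) * ?E \<le> (size P + size Q + 1) * ?E"
    "(size Q + 1) * ?E \<le> (size P + size Q + 1) * ?E" "1 \<le> ?E"
    by (intro mult_le_mono1; simp)+ simp
  ultimately have "max (cost N P) (cost N Q) + 1 \<le> (size P + size Q + 1) * ?E + ?E"
    by (meson add_mono le_trans max.boundedI)
  then show ?case by (simp add: algebra_simps)
next
  case (WhileNZ r P)
  then obtain e' where e: "e = Suc e'" and "cost N P \<le> (size P + 1) * (N + 1) ^ e'"
    by (cases e) auto
  then have "N * (cost N P + 1) + 1 \<le> N * ((size P + 1) * (N + 1) ^ e' + (N + 1) ^ e') + (N + 1) ^ e'"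
    by (intro add_mono mult_mono) auto
  also have "\<dots> \<le> (size (WhileNZ r P) + 1) * (N + 1) ^ e" by (simp add: e algebra_simps)
  finally show ?case by simp
qed simp

text \<open>Register \<open>0\<close> is reserved for the constant \<open>1\<close> and register \<open>1\<close> for the constant \<open>0\<close>. Addition
  is restricted to increments, so that no cell can outgrow the input by more than the running time;
  this makes the space bound a consequence of the time bound.\<close>

fun tame_instr :: "instr \<Rightarrow> bool" where
  "tame_instr (Const r c) \<longleftrightarrow> (if r \<le> 1 then c = 1 - r else c \<le> 3)"
| "tame_instr (Add r p q) \<longleftrightarrow> 2 \<le> r \<and> q = 0"
| "tame_instr (Sub r p q) \<longleftrightarrow> 2 \<le> r"
| "tame_instr (Read r p) \<longleftrightarrow> 2 \<le> r"
| "tame_instr (Write r) \<longleftrightarrow> True"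
| "tame_instr _ \<longleftrightarrow> False"

fun tame :: "prog \<Rightarrow> bool" where
  "tame (Instr i) = tame_instr i"
| "tame (Seq P Q) \<longleftrightarrow> tame P \<and> tame Q"
| "tame (IfNZ r P Q) \<longleftrightarrow> tame P \<and> tame Q"
| "tame (WhileNZ r P) = tame P"

text \<open>A constant stored into register \<open>0\<close> or \<open>1\<close> counts as no write,
  since \<open>tame\<close> allows there only the value that a \<open>good\<close> memory already
  holds. \<open>Store\<close> is charged with every register because its target is computed.\<close>

fun instr_writes :: "instr \<Rightarrow> nat set" where
  "instr_writes (Const r c) = (if r \<le> 1 then {} else {r})"
| "instr_writes (Add r p q) = {r}"
| "instr_writes (Sub r p q) = {r}"
| "instr_writes (Load r p) = {r}"
| "instr_writes (Store r p) = UNIV"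
| "instr_writes (InLen r) = {r}"
| "instr_writes (Read r p) = {r}"
| "instr_writes (Write r) = {}"

fun writes :: "prog \<Rightarrow> nat set" where
  "writes (Instr i) = instr_writes i"
| "writes (Seq P Q) = writes P \<union> writes Q"
| "writes (IfNZ r P Q) = writes P \<union> writes Q"
| "writes (WhileNZ r P) = writes P"

fun silent :: "prog \<Rightarrow> bool" where
  "silent (Instr i) \<longleftrightarrow> (\<forall>r. i \<noteq> Write r)"
| "silent (Seq P Q) \<longleftrightarrow> silent P \<and> silent Q"
| "silent (IfNZ r P Q) \<longleftrightarrow> silent P \<and> silent Q"
| "silent (WhileNZ r P) = silent P"

section \<open>Frame conditions and weakest preconditions with time bounds\<close>

definition good :: "mem \<Rightarrow> bool" where
  "good m \<longleftrightarrow> m 0 = 1 \<and> m 1 = 0"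

lemma good_upd [simp]: "2 \<le> r \<Longrightarrow> good (m(r := v)) = good m"
  by (auto simp: good_def)

definition frame :: "prog \<Rightarrow> nat list \<Rightarrow> mem \<Rightarrow> nat list \<Rightarrow> mem \<Rightarrow> bool" where
  "frame P o1 m o2 m' \<longleftrightarrow> good m' \<and> (\<forall>r. r \<notin> writes P \<longrightarrow> m' r = m r) \<and> (silent P \<longrightarrow> o2 = o1)"

lemma emitted_silent: "\<forall>r. i \<noteq> Write r \<Longrightarrow> emitted i m = []"
  by (cases i) auto

lemma exec_frame:
  "exec w P m t s out m' \<Longrightarrow> tame P \<Longrightarrow> good m \<Longrightarrow> frame P o1 m (o1 @ out) m'"
proof (induction arbitrary: o1 rule: exec.induct)
  case (Instr i m)
  then show ?case
    by (cases i) (auto simp: frame_def good_def fun_upd_def)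
next
  case (Seq P m t s out m' Q t' s' out' m'')
  have 1: "frame P o1 m (o1 @ out) m'" using Seq by simp
  then have "good m'" by (simp add: frame_def)
  then have "frame Q (o1 @ out) m' ((o1 @ out) @ out') m''"
    using Seq.IH(2)[of "o1 @ out"] Seq.prems by simp
  with 1 show ?case by (simp add: frame_def)
next
  case (WhileTrue m r P t s out m' t' s' out' m'')
  have 1: "frame P o1 m (o1 @ out) m'" using WhileTrue by simp
  then have "good m'" by (simp add: frame_def)
  then have "frame (WhileNZ r P) (o1 @ out) m' ((o1 @ out) @ out') m''"
    using WhileTrue.IH(2)[of "o1 @ out"] WhileTrue.prems by simp
  with 1 show ?case by (simp add: frame_def)
qed (auto simp: frame_def)

text \<open>Total correctness with the time bound built in: a halting run within \<open>cost\<close>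
  exists. \<open>out\<close> is the output emitted before, so postconditions see the whole
  stream.\<close>

definition wp :: "nat \<Rightarrow> nat list \<Rightarrow> prog \<Rightarrow> (nat list \<Rightarrow> mem \<Rightarrow> bool) \<Rightarrow> nat list \<Rightarrow> mem \<Rightarrow> bool" where
  "wp N w P Q out m \<longleftrightarrow>
    (\<exists>t s out' m'. exec w P m t s out' m' \<and> t \<le> cost N P \<and> Q (out @ out') m')"

lemma wp_Instr: "Q (out @ emitted i m) (effect w i m) \<Longrightarrow> wp N w (Instr i) Q out m"
  unfolding wp_def by (metis cost.simps(1) exec.Instr le_refl)

lemma wp_Seq: "wp N w P (wp N w R Q) out m \<Longrightarrow> wp N w (Seq P R) Q out m"
  unfolding wp_def by (fastforce intro: exec.Seq)

lemma wp_IfNZ: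
  assumes "m r \<noteq> 0 \<Longrightarrow> wp N w P Q out m" "m r = 0 \<Longrightarrow> wp N w R Q out m"
  shows "wp N w (IfNZ r P R) Q out m"
proof (cases "m r = 0")
  case True
  then show ?thesis using assms(2) unfolding wp_def by (fastforce intro: exec.IfFalse)
next
  case False
  then show ?thesis using assms(1) unfolding wp_def by (fastforce intro: exec.IfTrue)
qed

lemma wp_frame:
  assumes "wp N w P Q out m" "tame P" "good m"
    and "\<And>out' m'. Q out' m' \<Longrightarrow> frame P out m out' m' \<Longrightarrow> R out' m'"
  shows "wp N w P R out m"
  using assms exec_frame unfolding wp_def by blast

lemma wp_mono:
  "wp N w P Q out m \<Longrightarrow> (\<And>out' m'. Q out' m' \<Longrightarrow> R out' m') \<Longrightarrow> wp N w P R out m"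
  unfolding wp_def by blast

lemma frame_refl: "good m \<Longrightarrow> frame P out m out m"
  by (simp add: frame_def)

lemma frame_trans:
  "frame P o1 m1 o2 m2 \<Longrightarrow> frame P' o2 m2 o3 m3 \<Longrightarrow> writes P' \<subseteq> writes P \<Longrightarrow>
    (silent P \<Longrightarrow> silent P') \<Longrightarrow> frame P o1 m1 o3 m3"
  unfolding frame_def by (metis subsetD)

text \<open>The number \<open>K\<close> of iterations is known in advance and indexes the invariant,
  which yields termination and, through \<open>K \<le> N\<close>, the time bound at once. The frame
  relative to the loop entry is supplied for free, so an invariant need mention only what the loop
  changes.\<close>

lemma wp_While:
  assumes init: "I 0 out m" and "K \<le> N" and "tame P" "good m"
    and step: "\<And>j out' m'. j < K \<Longrightarrow> I j out' m' \<Longrightarrow> frame P out m out' m' \<Longrightarrow>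
      m' r \<noteq> 0 \<and> wp N w P (I (Suc j)) out' m'"
    and fin: "\<And>out' m'. I K out' m' \<Longrightarrow> frame P out m out' m' \<Longrightarrow> m' r = 0 \<and> Q out' m'"
  shows "wp N w (WhileNZ r P) Q out m"
proof -
  have "\<exists>t s out'' m''. exec w (WhileNZ r P) m' t s out'' m'' \<and>
      t \<le> (K - j) * (cost N P + 1) + 1 \<and> Q (out' @ out'') m''"
    if "j \<le> K" "I j out' m'" "frame P out m out' m'" for j out' m'
    using that
  proof (induction arbitrary: out' m' rule: inc_induct)
    case base
    then have "m' r = 0" "Q out' m'" using fin by auto
    then have "exec w (WhileNZ r P) m' 1 (space m') [] m' \<and>
        1 \<le> (K - K) * (cost N P + 1) + 1 \<and> Q (out' @ []) m'"
      using exec.WhileFalse by auto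
    then show ?case by blast
  next
    case (step j)
    note A = assms(5)[OF step.hyps(2) step.prems]
    then have "wp N w P (I (Suc j)) out' m'" ..
    from this \<open>tame P\<close> have "wp N w P (\<lambda>o1 m1. I (Suc j) o1 m1 \<and> frame P out m o1 m1) out' m'"
      by (rule wp_frame) (use step.prems(2) frame_trans in \<open>auto simp: frame_def\<close>)
    then obtain t s o1 m1 where 1: "exec w P m' t s o1 m1" "t \<le> cost N P"
      "I (Suc j) (out' @ o1) m1" "frame P out m (out' @ o1) m1"
      unfolding wp_def by blast
    from step.IH[OF 1(3,4)] obtain t' s' o2 m2 where 2: "exec w (WhileNZ r P) m1 t' s' o2 m2"
      "t' \<le> (K - Suc j) * (cost N P + 1) + 1" "Q ((out' @ o1) @ o2) m2"
      by blast
    have "exec w (WhileNZ r P) m' (t + t' + 1) (max s s') (o1 @ o2) m2"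
      using A 1(1) 2(1) exec.WhileTrue by blast
    moreover have "t + t' + 1 \<le> (K - j) * (cost N P + 1) + 1"
    proof -
      have "K - j = Suc (K - Suc j)" using step.hyps by simp
      then show ?thesis using 1(2) 2(2) by simp
    qed
    ultimately show ?case using 2(3) by (metis append.assoc)
  qed
  from this[of 0, OF _ init frame_refl[OF \<open>good m\<close>]] obtain t s out'' m'' where
    "exec w (WhileNZ r P) m t s out'' m''" "t \<le> K * (cost N P + 1) + 1" "Q (out @ out'') m''"
    by auto
  moreover have "K * (cost N P + 1) + 1 \<le> cost N (WhileNZ r P)"
    using \<open>K \<le> N\<close> mult_le_mono1[of K N "cost N P + 1"] by simp
  ultimately show ?thesis unfolding wp_def by (meson le_trans)
qed

text \<open>The machine has no idle instruction; writing \<open>0\<close> into register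
  \<open>1\<close> is one in every \<open>good\<close> memory.\<close>

definition skip :: prog where "skip = Instr (Const 1 0)"

fun seqs :: "prog list \<Rightarrow> prog" where
  "seqs [] = skip"
| "seqs (P # Ps) = Seq P (seqs Ps)"

lemma skip_simps [simp]: "tame skip" "writes skip = {}" "silent skip" "loop_depth skip = 0"
  by (auto simp: skip_def)

lemma seqs_simps [simp]:
  "tame (seqs Ps) \<longleftrightarrow> (\<forall>P \<in> set Ps. tame P)"
  "writes (seqs Ps) = (\<Union>P \<in> set Ps. writes P)"
  "silent (seqs Ps) \<longleftrightarrow> (\<forall>P \<in> set Ps. silent P)"
  "loop_depth (seqs Ps) \<le> e \<longleftrightarrow> (\<forall>P \<in> set Ps. loop_depth P \<le> e)"
  by (induction Ps) auto

lemma wp_skip: "good m \<Longrightarrow> Q out m \<Longrightarrow> wp N w skip Q out m"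
  unfolding skip_def by (rule wp_Instr) (auto simp: good_def fun_upd_idem)

text \<open>Counterpart of \<open>wp_While\<close> for unrolled code, with the invariant indexed by
  the number of blocks executed. Repetitions whose number depends on \<open>d\<close> only go
  through it and add no loop level.\<close>

lemma wp_seqs:
  assumes "I 0 out m" "tame (seqs Ps)" "good m"
    and "\<And>j out' m'. j < length Ps \<Longrightarrow> I j out' m' \<Longrightarrow> frame (seqs Ps) out m out' m' \<Longrightarrow>
      wp N w (Ps ! j) (I (Suc j)) out' m'"
    and fin: "\<And>out' m'. I (length Ps) out' m' \<Longrightarrow> frame (seqs Ps) out m out' m' \<Longrightarrow> Q out' m'"
  shows "wp N w (seqs Ps) Q out m"
proof -
  have "wp N w (seqs (drop j Ps)) Q out' m'"
    if "j \<le> length Ps" "I j out' m'" "frame (seqs Ps) out m out' m'" for j out' m'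
    using that
  proof (induction arbitrary: out' m' rule: inc_induct)
    case base
    then show ?case using fin by (auto intro!: wp_skip simp: frame_def)
  next
    case (step j)
    have P: "Ps ! j \<in> set Ps" using step.hyps by simp
    have sub: "writes (Ps ! j) \<subseteq> writes (seqs Ps)" "silent (seqs Ps) \<Longrightarrow> silent (Ps ! j)" using P by auto
    have "wp N w (Ps ! j) (wp N w (seqs (drop (Suc j) Ps)) Q) out' m'"
    proof (rule wp_frame[OF assms(4)[OF step.hyps(2) step.prems]])
      show "tame (Ps ! j)" "good m'" using P assms(2) step.prems(2) by (auto simp: frame_def)
      show "wp N w (seqs (drop (Suc j) Ps)) Q o1 m1"
        if "I (Suc j) o1 m1" "frame (Ps ! j) out' m' o1 m1" for o1 m1
        using step.IH that frame_trans[OF step.prems(2)] sub by blast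
    qed
    then have "wp N w (seqs (Ps ! j # drop (Suc j) Ps)) Q out' m'" by (simp add: wp_Seq)
    then show ?case using Cons_nth_drop_Suc[OF step.hyps(2)] by simp
  qed
  from this[of 0, OF _ assms(1) frame_refl[OF \<open>good m\<close>]] show ?thesis by simp
qed

section \<open>Working space from running time\<close>

definition bits :: "nat \<Rightarrow> nat" where
  "bits a = nat (bitlen (int a))"

lemma bits_mono: "a \<le> b \<Longrightarrow> bits a \<le> bits b"
  using less_power_nat_iff_bitlen[of b "bits b"] less_power_nat_iff_bitlen[of a "bits b"]
    bitlen_nonneg[of "int b"]
  by (simp add: bits_def) 

lemma bits_le_log: "real (bits a) \<le> log 2 (real a + 1) + 1"
proof (cases "a = 0")
  case False
  then have "real (bits a) = of_int \<lfloor>log 2 (real a)\<rfloor> + 1"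
    by (simp add: bits_def bitlen_alt_def)
  also have "\<dots> \<le> log 2 (real a) + 1" by simp
  also have "log 2 (real a) \<le> log 2 (real a + 1)" using False by simp
  finally show ?thesis by simp
qed (simp add: bits_def)

text \<open>The first conjunct also holds for the all-zero start, where \<open>good\<close> fails.
  It limits an increment by register \<open>0\<close> to \<open>1\<close>, so that a
  \<open>tame\<close> step raises the bound \<open>B\<close> by at most one.\<close>

definition bounded :: "nat \<Rightarrow> nat \<Rightarrow> mem \<Rightarrow> bool" where
  "bounded R B m \<longleftrightarrow> m 0 \<le> 1 \<and> (\<forall>r. m r \<le> B) \<and> (\<forall>r \<ge> R. m r = 0)"

lemma bounded_mono: "bounded R B m \<Longrightarrow> B \<le> B' \<Longrightarrow> bounded R B' m"
  unfolding bounded_def by (meson le_trans)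

lemma space_le:
  assumes "bounded R B m"
  shows "space m \<le> R * (bits R + bits B)"
proof -
  have "space m = (\<Sum>a | m a \<noteq> 0. bits a + bits (m a))"
    by (simp add: space_def bits_def)
  also have "\<dots> \<le> (\<Sum>a < R. bits a + bits (m a))"
    using assms by (intro sum_mono2) (auto simp: bounded_def not_less[symmetric])
  also have "\<dots> \<le> (\<Sum>a < R. bits R + bits B)"
    using assms by (intro sum_mono add_mono bits_mono) (auto simp: bounded_def)
  finally show ?thesis by simp
qed

lemma exec_bounded:
  assumes "exec w P m t s out m'" "tame P" "writes P \<subseteq> {..<R}" "2 \<le> R" "bounded R B m"
    and "length w \<le> B" "\<forall>x \<in> set w. x \<le> B" "3 \<le> B"
  shows "bounded R (B + t) m' \<and> s \<le> R * (bits R + bits (B + t))"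
  using assms
proof (induction arbitrary: B rule: exec.induct)
  case (Instr i m)
  have "bounded R (B + 1) (effect w i m)"
  proof (cases i)
    case (Const r c)
    then show ?thesis using Instr by (auto simp: bounded_def le_Suc_eq split: if_splits)
  next
    case (Add r p q)
    moreover have "m p + m 0 \<le> B + 1"
      using Instr.prems(4) unfolding bounded_def by (intro add_mono) auto
    ultimately show ?thesis using Instr by (auto simp: bounded_def le_SucI)
  next
    case (Sub r p q)
    then show ?thesis using Instr by (auto simp: bounded_def le_SucI le_diff_conv trans_le_add1)
  next
    case (Read r p)
    then show ?thesis using Instr by (auto simp: bounded_def le_SucI)
  qed (use Instr in \<open>auto simp: bounded_def le_SucI\<close>)
  moreover have "bounded R (B + 1) m" using Instr.prems bounded_mono by auto
  ultimately show ?case using space_le by simp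
next
  case (Seq P m t s out m' Q t' s' out' m'')
  from Seq have 1: "bounded R (B + t) m'" "s \<le> R * (bits R + bits (B + t))" by auto
  have "length w \<le> B + t" "\<forall>x \<in> set w. x \<le> B + t" "3 \<le> B + t"
    using Seq.prems by (auto simp: trans_le_add1)
  then have 2: "bounded R (B + t + t') m''" "s' \<le> R * (bits R + bits (B + t + t'))"
    using Seq.IH(2)[of "B + t"] Seq.prems(1-3) 1(1) by auto
  have "R * (bits R + bits (B + t)) \<le> R * (bits R + bits (B + t + t'))"
    by (rule mult_le_mono2[OF add_left_mono[OF bits_mono]]) simp
  with 1(2) have "s \<le> R * (bits R + bits (B + t + t'))" by (rule le_trans)
  with 2 show ?case by (simp add: add.assoc)
next
  case (WhileTrue m r P t s out m' t' s' out' m'')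
  from WhileTrue have 1: "bounded R (B + t) m'" "s \<le> R * (bits R + bits (B + t))" by auto
  have "length w \<le> B + t" "\<forall>x \<in> set w. x \<le> B + t" "3 \<le> B + t"
    using WhileTrue.prems by (auto simp: trans_le_add1)
  then have 2: "bounded R (B + t + t') m''" "s' \<le> R * (bits R + bits (B + t + t'))"
    using WhileTrue.IH(2)[of "B + t"] WhileTrue.prems(1-3) 1(1) by auto
  have "R * (bits R + bits (B + t)) \<le> R * (bits R + bits (B + (t + t' + 1)))"
    "R * (bits R + bits (B + t + t')) \<le> R * (bits R + bits (B + (t + t' + 1)))"
    by (rule mult_le_mono2[OF add_left_mono[OF bits_mono]]; simp)+
  with 1(2) 2(2) have "max s s' \<le> R * (bits R + bits (B + (t + t' + 1)))"
    by (meson le_trans max.boundedI)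
  then show ?case using bounded_mono[OF 2(1), of "B + (t + t' + 1)"] by simp
next
  case (IfTrue m r P t s out m' Q)
  then have 1: "bounded R (B + t) m'" "s \<le> R * (bits R + bits (B + t))" by auto
  have "R * (bits R + bits (B + t)) \<le> R * (bits R + bits (B + (t + 1)))"
    by (rule mult_le_mono2[OF add_left_mono[OF bits_mono]]) simp
  with 1(2) have "s \<le> R * (bits R + bits (B + (t + 1)))" by (rule le_trans)
  then show ?case using bounded_mono[OF 1(1), of "B + (t + 1)"] by simp
next
  case (IfFalse m r Q t s out m' P)
  then have 1: "bounded R (B + t) m'" "s \<le> R * (bits R + bits (B + t))" by auto
  have "R * (bits R + bits (B + t)) \<le> R * (bits R + bits (B + (t + 1)))"
    by (rule mult_le_mono2[OF add_left_mono[OF bits_mono]]) simp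
  with 1(2) have "s \<le> R * (bits R + bits (B + (t + 1)))" by (rule le_trans)
  then show ?case using bounded_mono[OF 1(1), of "B + (t + 1)"] by simp
next
  case (WhileFalse m r P)
  then have "bounded R (B + 1) m" using bounded_mono by auto
  then show ?case using space_le by simp
qed

section \<open>The kernelization program\<close>

abbreviation seq_infix :: "prog \<Rightarrow> prog \<Rightarrow> prog" (infixr ";;" 60) where
  "P ;; Q \<equiv> Seq P Q"

abbreviation "set_const r c \<equiv> Instr (Const r c)"
abbreviation "inc r \<equiv> Instr (Add r r 0)"
abbreviation "dec r \<equiv> Instr (Sub r r 0)"
abbreviation "sub r p q \<equiv> Instr (Sub r p q)"
abbreviation "copy r p \<equiv> Instr (Sub r p 1)"
abbreviation "read r p \<equiv> Instr (Read r p)"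
abbreviation "emit r \<equiv> Instr (Write r)"

text \<open>
  \<open>reg l i\<close> are the registers of level \<open>l\<close> of the survival test: \<open>0\<close> the position of the tested set, \<open>1\<close> the
  answer, \<open>2\<close> the remaining threshold, \<open>3\<close> the distance to the end of the scan, \<open>4\<close> a flag, \<open>5\<close> a
  counter of \<open>add_power\<close>. Registers \<open>2\<close> to \<open>7\<close> are scratch, and \<open>8\<close> to \<open>20\<close> belong to the main program,
  with \<open>k\<close> in \<open>8\<close>, the number of sets in \<open>9\<close> and \<open>q\<close> in \<open>10\<close>.
\<close>

definition reg :: "nat \<Rightarrow> nat \<Rightarrow> nat" where
  "reg l i = 21 + 6 * l + i"

lemma reg_eq [simp]: "i < 6 \<Longrightarrow> j < 6 \<Longrightarrow> reg l i = reg l' j \<longleftrightarrow> l = l' \<and> i = j"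
  unfolding reg_def by presburger

lemma reg_ne [simp]: "v < 21 \<Longrightarrow> reg l i \<noteq> v" "v < 21 \<Longrightarrow> v \<noteq> reg l i"
  unfolding reg_def by auto

lemma reg_ge [simp]: "c \<le> 21 \<Longrightarrow> c \<le> reg l i"
  unfolding reg_def by auto

lemma reg_not_le [simp]: "\<not> reg l i \<le> Suc 0"
  unfolding reg_def by auto

text \<open>Adding the size word to the pointer at once would not be \<open>tame\<close>; as sizes
  are at most \<open>d\<close>, guarded increments do the same without a loop.\<close>

definition advance :: "nat \<Rightarrow> nat \<Rightarrow> prog" where
  "advance d a = read 2 a ;; inc a ;; seqs (replicate d (IfNZ 2 (dec 2 ;; inc a) skip))"

text \<open>Register \<open>5\<close> becomes \<open>0\<close> iff the next entry of the padded set exists and equals \<open>m x\<close>.\<close>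

definition probe :: "nat \<Rightarrow> nat \<Rightarrow> nat \<Rightarrow> prog" where
  "probe e s x = IfNZ s (inc e ;; dec s ;; read 4 e ;; sub 5 4 x ;; IfNZ 5 skip (sub 5 x 4)) (set_const 5 1)"

definition member :: "nat \<Rightarrow> nat \<Rightarrow> prog" where
  "member d a = copy 3 a ;; read 2 a ;; set_const 7 0 ;;
    seqs (replicate d (probe 3 2 6 ;; IfNZ 5 skip (set_const 7 1)))"

text \<open>After \<open>j\<close> truncated decrements register \<open>2\<close> is nonzero iff the
  set at \<open>a\<close> has an element with index \<open>j\<close>. If it has none, register
  \<open>7\<close> stays \<open>0\<close> and \<open>z\<close> is cleared, as if containment had
  failed.\<close>

definition contains_nth :: "nat \<Rightarrow> nat \<Rightarrow> nat \<Rightarrow> nat \<Rightarrow> nat \<Rightarrow> prog" where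
  "contains_nth d a b z j = copy 3 a ;; read 2 a ;; seqs (replicate j (dec 2 ;; inc 3)) ;; set_const 7 0 ;;
    IfNZ 2 (inc 3 ;; read 6 3 ;; member d b) skip ;; IfNZ 7 skip (set_const z 0)"

definition contains :: "nat \<Rightarrow> nat list \<Rightarrow> nat \<Rightarrow> nat \<Rightarrow> nat \<Rightarrow> prog" where
  "contains d js a b z = set_const z 1 ;; seqs (map (contains_nth d a b z) js)"

text \<open>Without multiplication, \<open>q ^ j\<close> is reached by \<open>j\<close> nested loops
  of \<open>q\<close> iterations each; every level owns a counter \<open>reg i 5\<close>.\<close>

fun add_power :: "nat \<Rightarrow> nat \<Rightarrow> prog" where
  "add_power 0 r = inc r"
| "add_power (Suc j) r = copy (reg j 5) 10 ;; WhileNZ (reg j 5) (add_power j r ;; dec (reg j 5))"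

text \<open>\<open>js\<close> lists the indices of \<open>C\<close> in the tested set. The remaining
  threshold is counted down with truncation, so it ends at \<open>0\<close> iff the limit is
  reached. The scan pointer doubles as the argument \<open>reg l 0\<close> of the inner test; it
  starts at \<open>3\<close>, behind the three header words.\<close>

definition threshold_check :: "nat \<Rightarrow> nat \<Rightarrow> prog \<Rightarrow> nat list \<Rightarrow> prog" where
  "threshold_check d l T js =
    set_const (reg (Suc l) 2) 0 ;; add_power (Suc l) (reg (Suc l) 2) ;;
    set_const (reg l 0) 3 ;; sub (reg (Suc l) 3) (reg (Suc l) 0) (reg l 0) ;;
    WhileNZ (reg (Suc l) 3)
      (contains d js (reg (Suc l) 0) (reg l 0) (reg (Suc l) 4) ;;
       IfNZ (reg (Suc l) 4) (T ;; IfNZ (reg l 1) (dec (reg (Suc l) 2)) skip) skip ;;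
       advance d (reg l 0) ;; sub (reg (Suc l) 3) (reg (Suc l) 0) (reg l 0)) ;;
    IfNZ (reg (Suc l) 2) skip (set_const (reg (Suc l) 1) 0)"

text \<open>Subsets of the tested set are represented by increasing index lists. These are known
  when the program is built, so trying all of them adds program text but no loop level.\<close>

definition index_lists :: "nat \<Rightarrow> nat \<Rightarrow> nat list list" where
  "index_lists d c = filter (\<lambda>js. length js = c) (subseqs [0..<d])"

text \<open>The machine has no procedures: the code of level \<open>l\<close> is copied to every
  place of use, and the size of the result depends on \<open>d\<close> only.\<close>

fun survival_test :: "nat \<Rightarrow> nat \<Rightarrow> prog" where
  "survival_test d 0 = set_const (reg 0 1) 1"
| "survival_test d (Suc l) =
    copy (reg l 0) (reg (Suc l) 0) ;; survival_test d l ;; copy (reg (Suc l) 1) (reg l 1) ;;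
    seqs (map (threshold_check d l (survival_test d l)) (index_lists d (d - Suc l)))"

text \<open>The output header contains the universe size and the number of sets, and emitted words
  cannot be revised; hence a counting pass before anything is written.\<close>

definition count_survivors :: "nat \<Rightarrow> prog" where
  "count_survivors d = set_const 11 0 ;; set_const 12 0 ;; copy 13 9 ;; set_const (reg d 0) 3 ;;
    WhileNZ 13 (survival_test d d ;;
      IfNZ (reg d 1) (inc 11 ;; seqs (replicate d (inc 12))) skip ;;
      advance d (reg d 0) ;; dec 13)"

text \<open>Register \<open>19\<close> stays \<open>1\<close> until the element in register
  \<open>17\<close> is met; until then each of the \<open>d\<close> slots per survivor, padding
  included, increments register \<open>18\<close>.\<close>

definition find_label :: "nat \<Rightarrow> prog" where
  "find_label d = set_const 18 0 ;; set_const 19 1 ;; set_const (reg d 0) 3 ;; copy 20 9 ;;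
    WhileNZ 20 (survival_test d d ;;
      IfNZ (reg d 1) (copy 3 (reg d 0) ;; read 2 (reg d 0) ;;
        seqs (replicate d (probe 3 2 17 ;; IfNZ 5 (IfNZ 19 (inc 18) skip) (set_const 19 0)))) skip ;;
      advance d (reg d 0) ;; dec 20)"

definition write_set :: "nat \<Rightarrow> prog" where
  "write_set d = read 15 14 ;; emit 15 ;; copy 16 14 ;;
    seqs (replicate d (IfNZ 15 (inc 16 ;; dec 15 ;; read 17 16 ;; find_label d ;; emit 18) skip))"

text \<open>\<open>find_label\<close> runs its own scan with \<open>reg d 0\<close>, so the outer
  scan keeps its position in register \<open>14\<close> and hands over a copy.\<close>

definition write_family :: "nat \<Rightarrow> prog" where
  "write_family d = copy 13 9 ;; set_const 14 3 ;;
    WhileNZ 13 (copy (reg d 0) 14 ;; survival_test d d ;; IfNZ (reg d 1) (write_set d) skip ;;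
      advance d 14 ;; dec 13)"

text \<open>The two subtractions compute \<open>min k n\<close>, \<open>n\<close> the number of sets. Without this cap, counting up to
  \<open>q ^ l\<close> would take time depending on \<open>k\<close>.\<close>

definition kernel_prog :: "nat \<Rightarrow> prog" where
  "kernel_prog d = set_const 0 1 ;; read 8 1 ;; set_const 9 2 ;; read 9 9 ;;
    sub 10 8 9 ;; sub 10 8 10 ;; inc 10 ;;
    count_survivors d ;; emit 8 ;; emit 12 ;; emit 11 ;; write_family d"

section \<open>Syntactic properties of the program: tameness, written registers, loop depth\<close>

lemma tame_silent_basic [simp]:
  "2 \<le> a \<Longrightarrow> tame (advance d a)" "silent (advance d a)"
  "2 \<le> e \<Longrightarrow> 2 \<le> s \<Longrightarrow> tame (probe e s x)" "silent (probe e s x)"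
  "tame (member d a)" "silent (member d a)"
  "2 \<le> z \<Longrightarrow> tame (contains_nth d a b z j)" "silent (contains_nth d a b z j)"
  "2 \<le> z \<Longrightarrow> tame (contains d js a b z)" "silent (contains d js a b z)"
  by (auto simp: advance_def probe_def member_def contains_def contains_nth_def)

lemma tame_silent_add_power [simp]:
  "2 \<le> r \<Longrightarrow> tame (add_power j r)" "silent (add_power j r)"
  by (induction j) auto

lemma tame_silent_survival_test [simp]: "tame (survival_test d l)" "silent (survival_test d l)"
  by (induction l) (auto simp: threshold_check_def)

lemma tame_silent_threshold_check [simp]:
  "tame (threshold_check d l (survival_test d l) js)"
  "silent (threshold_check d l (survival_test d l) js)"
  by (auto simp: threshold_check_def)

lemma tame_find_label [simp]: "tame (find_label d)" "silent (find_label d)"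
  and tame_write_set [simp]: "tame (write_set d)"
  by (auto simp: find_label_def write_set_def)

lemma tame_kernel_prog: "tame (kernel_prog d)"
  by (auto simp: kernel_prog_def count_survivors_def write_family_def)

lemma writes_basic:
  "2 \<le> a \<Longrightarrow> r \<in> writes (advance d a) \<Longrightarrow> r = a \<or> r = 2"
  "2 \<le> e \<Longrightarrow> 2 \<le> s \<Longrightarrow> r \<in> writes (probe e s x) \<Longrightarrow> r \<in> {e, s, 4, 5}"
  "r \<in> writes (member d a) \<Longrightarrow> r \<in> {2, 3, 4, 5, 7}"
  "r \<in> writes (contains_nth d a b z j) \<Longrightarrow> r \<in> {2, 3, 4, 5, 6, 7, z}"
  "r \<in> writes (contains d js a b z) \<Longrightarrow> r \<in> {2, 3, 4, 5, 6, 7, z}"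
  by (auto simp: advance_def probe_def member_def contains_def contains_nth_def split: if_splits)

lemma writes_add_power: "r' \<in> writes (add_power j r) \<Longrightarrow> r' = r \<or> (\<exists>i < j. r' = reg i 5)"
  by (induction j) (auto simp: less_Suc_eq)

text \<open>Separates the levels: a test leaves alone its own argument, all registers of higher
  levels and the registers \<open>8\<close> to \<open>20\<close> of the main program, so callers
  keep their state.\<close>

lemma writes_survival_test:
  "r \<in> writes (survival_test d l) \<Longrightarrow> 2 \<le> r \<and> r \<le> reg l 5 \<and> r \<noteq> reg l 0 \<and> (r \<le> 7 \<or> 21 \<le> r)"
proof (induction l arbitrary: r)
  case 0
  then show ?case by (simp add: reg_def)
next
  case (Suc l)
  define S where "S = {r. 2 \<le> r \<and> r \<le> reg (Suc l) 5 \<and> r \<noteq> reg (Suc l) 0 \<and> (r \<le> 7 \<or> 21 \<le> r)}"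
  have IH: "writes (survival_test d l) \<subseteq> S"
    using Suc.IH by (fastforce simp: reg_def S_def)
  have pw: "writes (add_power (Suc l) (reg (Suc l) 2)) \<subseteq> S"
  proof
    fix r assume "r \<in> writes (add_power (Suc l) (reg (Suc l) 2))"
    from writes_add_power[OF this] consider "r = reg (Suc l) 2" | i where "i \<le> l" "r = reg i 5"
      by auto
    then show "r \<in> S"
    proof cases
      case (2 i)
      have "6 * i \<noteq> Suc (6 * l)" by presburger
      then show ?thesis using 2 by (auto simp: reg_def S_def)
    qed (auto simp: reg_def S_def)
  qed
  have co: "writes (contains d js (reg (Suc l) 0) (reg l 0) (reg (Suc l) 4)) \<subseteq> S" for js
  proof
    fix r assume "r \<in> writes (contains d js (reg (Suc l) 0) (reg l 0) (reg (Suc l) 4))"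
    from writes_basic(5)[OF this] show "r \<in> S" unfolding S_def by (auto simp: reg_def)
  qed
  have ad: "writes (advance d (reg l 0)) \<subseteq> S"
  proof
    fix r assume "r \<in> writes (advance d (reg l 0))"
    from writes_basic(1)[OF _ this] show "r \<in> S" unfolding S_def by (auto simp: reg_def)
  qed
  have ba: "reg l 0 \<in> S" "reg (Suc l) 1 \<in> S" "reg (Suc l) 2 \<in> S" "reg (Suc l) 3 \<in> S"
    by (auto simp: reg_def S_def)
  have "writes (threshold_check d l (survival_test d l) js) \<subseteq> S" for js
    by (simp add: threshold_check_def IH pw co ad ba del: add_power.simps One_nat_def)
  then have "writes (survival_test d (Suc l)) \<subseteq> S"
    by (simp add: IH ba UN_subset_iff del: One_nat_def)
  then show ?case using Suc.prems unfolding S_def by blast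
qed

lemma loop_depth_basic [simp]:
  "loop_depth (advance d a) \<le> e" "loop_depth (probe s x y) \<le> e" "loop_depth (member d a) \<le> e"
  "loop_depth (contains_nth d a b z j) \<le> e" "loop_depth (contains d js a b z) \<le> e"
  by (auto simp: advance_def probe_def member_def contains_def contains_nth_def)

lemma loop_depth_add_power [simp]: "loop_depth (add_power j r) = j"
  by (induction j) auto

text \<open>Level \<open>Suc l\<close> puts one scan around level \<open>l\<close>. Computing
  \<open>q ^ Suc l\<close> also nests \<open>Suc l\<close> loops, but it stands before the scan and
  not inside it.\<close>

lemma loop_depth_survival_test [simp]: "loop_depth (survival_test d l) \<le> l"
proof (induction l)
  case (Suc l)
  then show ?case by (auto simp: threshold_check_def intro: le_SucI)
qed auto

lemma loop_depth_kernel_prog: "loop_depth (kernel_prog d) \<le> d + 2"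
proof -
  have "loop_depth (survival_test d d) \<le> d" "loop_depth (survival_test d d) \<le> Suc d"
    using loop_depth_survival_test[of d d] by linarith+
  moreover have "loop_depth (find_label d) \<le> d + 1" "loop_depth (count_survivors d) \<le> d + 1"
    using calculation by (auto simp: find_label_def count_survivors_def)
  moreover have "loop_depth (write_set d) \<le> d + 1"
    using calculation by (auto simp: write_set_def)
  moreover have "loop_depth (write_family d) \<le> d + 2"
    using calculation by (auto simp: write_family_def)
  ultimately show ?thesis by (auto simp: kernel_prog_def)
qed

section \<open>Correctness of the program\<close>

lemma silentD: "silent P \<Longrightarrow> frame P o1 m1 o2 m2 \<Longrightarrow> o2 = o1"
  and frame_good: "frame P o1 m1 o2 m2 \<Longrightarrow> good m2"
  and frame_eq: "frame P o1 m1 o2 m2 \<Longrightarrow> r \<notin> writes P \<Longrightarrow> m2 r = m1 r"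
  by (auto simp: frame_def)

lemma wp_Const: "Q out (m(r := c)) \<Longrightarrow> wp N w (Instr (Const r c)) Q out m"
  and wp_Add: "Q out (m(r := m p + m q)) \<Longrightarrow> wp N w (Instr (Add r p q)) Q out m"
  and wp_Sub: "Q out (m(r := m p - m q)) \<Longrightarrow> wp N w (Instr (Sub r p q)) Q out m"
  and wp_Read: "Q out (m(r := if m p < length w then w ! m p else 0)) \<Longrightarrow>
    wp N w (Instr (Read r p)) Q out m"
  and wp_Write: "Q (out @ [m r]) m \<Longrightarrow> wp N w (Instr (Write r)) Q out m"
  by (rule wp_Instr, simp)+

lemmas wp_simple = wp_Seq wp_Const wp_Add wp_Sub wp_Read wp_Write wp_skip

text \<open>\<open>N\<close> is the cap for all loops. Strictness leaves room for the threshold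
  base, which may be as large as \<open>length Fs + 1\<close> and is itself a loop count in
  \<open>add_power\<close>.\<close>

locale hs_input =
  fixes d k u :: nat and Fs :: "nat list list" and w :: "nat list" and N :: nat
  assumes small: "\<And>X. X \<in> set Fs \<Longrightarrow> length X \<le> d"
    and dist: "\<And>X. X \<in> set Fs \<Longrightarrow> distinct X"
    and w: "w = encoding k u Fs"
    and N: "length Fs < N"
begin

abbreviation "W \<equiv> wp N w"

definition pos :: "nat \<Rightarrow> nat" where
  "pos i = 3 + length (concat (map (\<lambda>X. length X # X) (take i Fs)))"

lemma pos_0 [simp]: "pos 0 = 3"
  by (simp add: pos_def)

lemma pos_Suc: "i < length Fs \<Longrightarrow> pos (Suc i) = Suc (pos i + length (Fs ! i))"
  by (simp add: pos_def take_Suc_conv_app_nth)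

lemma pos_mono: "i < j \<Longrightarrow> j \<le> length Fs \<Longrightarrow> pos i < pos j"
proof (induction j)
  case (Suc j)
  then show ?case by (cases "i = j") (auto simp: pos_Suc)
qed simp

lemma w_split:
  assumes "i < length Fs"
  shows "\<exists>us vs. w = us @ (length (Fs ! i) # Fs ! i) @ vs \<and> length us = pos i"
proof -
  let ?f = "\<lambda>X. length X # X"
  have "concat (map ?f Fs) = concat (map ?f (take i Fs @ Fs ! i # drop (Suc i) Fs))"
    using id_take_nth_drop[OF assms] by simp
  then have "concat (map ?f Fs) = concat (map ?f (take i Fs)) @
      (length (Fs ! i) # Fs ! i) @ concat (map ?f (drop (Suc i) Fs))"
    by simp
  then show ?thesis unfolding w encoding_def
    by (intro exI[of _ "k # u # length Fs # concat (map (\<lambda>X. length X # X) (take i Fs))"]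
        exI[of _ "concat (map (\<lambda>X. length X # X) (drop (Suc i) Fs))"]) (simp add: pos_def)
qed

lemma read_size:
  assumes "i < length Fs"
  shows "pos i < length w" "w ! pos i = length (Fs ! i)"
  using w_split[OF assms] by (auto simp: nth_append)

lemma read_element:
  assumes "i < length Fs" "j < length (Fs ! i)"
  shows "Suc (pos i + j) < length w" "w ! Suc (pos i + j) = Fs ! i ! j"
  using w_split[OF assms(1)] assms(2) by (auto simp: nth_append)

lemma small_nth: "i < length Fs \<Longrightarrow> length (Fs ! i) \<le> d"
  by (simp add: small)

lemma wp_advance:
  assumes "good m" "m a = pos i" "i < length Fs" "8 \<le> a"
    and cont: "\<And>m'. good m' \<Longrightarrow> m' a = pos (Suc i) \<Longrightarrow> (\<And>r. r \<noteq> a \<Longrightarrow> r \<noteq> 2 \<Longrightarrow> m' r = m r) \<Longrightarrow> Q out m'"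
  shows "W (advance d a) Q out m"
proof -
  let ?X = "Fs ! i"
  let ?P = "IfNZ 2 (dec 2 ;; inc a) skip"
  let ?I = "\<lambda>j (o1 :: nat list) m1. m1 2 = length ?X - j \<and> m1 a = Suc (pos i + min j (length ?X))"
  have a: "a \<noteq> 0" "a \<noteq> 2" "2 \<le> a" using assms by auto
  define m1 where "m1 = m(2 := length ?X, a := Suc (pos i))"
  have m1: "good m1" using assms(1) a by (simp add: m1_def)
  have "W (seqs (replicate d ?P)) Q out m1"
  proof (rule wp_seqs[where I = ?I])
    fix j o2 m2
    assume j: "j < length (replicate d ?P)" and I: "?I j o2 m2"
      and F: "frame (seqs (replicate d ?P)) out m1 o2 m2"
    have "good m2" "m2 0 = 1" using frame_good[OF F] by (auto simp: good_def)
    then have "W ?P (?I (Suc j)) o2 m2"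
      using I a by (auto intro!: wp_IfNZ wp_simple)
    then show "W (replicate d ?P ! j) (?I (Suc j)) o2 m2" using j by simp
  next
    fix o2 m2
    assume I: "?I (length (replicate d ?P)) o2 m2"
      and F: "frame (seqs (replicate d ?P)) out m1 o2 m2"
    have "o2 = out" using silentD[OF _ F] by simp
    moreover have "m2 r = m r" if "r \<noteq> a" "r \<noteq> 2" for r
      using frame_eq[OF F, of r] that by (auto simp: m1_def)
    moreover have "m2 a = pos (Suc i)" using I pos_Suc[OF assms(3)] small_nth[OF assms(3)] by simp
    ultimately show "Q o2 m2" using cont frame_good[OF F] by blast
  qed (use m1 a in \<open>auto simp: m1_def\<close>)
  then show ?thesis unfolding advance_def
    by (intro wp_simple) (use assms(1,2) a read_size[OF assms(3)] in \<open>simp add: m1_def good_def\<close>)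
qed

text \<open>When \<open>j\<close> padded entries are consumed, the pointer rests on the last word
  read and sticks there once the set is exhausted, whence \<open>min\<close>. Two truncated
  subtractions decide equality, since both vanish only for equal numbers.\<close>

lemma wp_probe:
  assumes "good m" "i < length Fs" "m s = length (Fs ! i) - j" "m e = pos i + min j (length (Fs ! i))"
    and regs: "2 \<le> e" "2 \<le> s" "e \<notin> {s, 4, 5}" "s \<notin> {4, 5}" "x \<notin> {e, s, 4, 5}"
    and "j < d"
    and cont: "\<And>m'. good m' \<Longrightarrow> m' s = length (Fs ! i) - Suc j \<Longrightarrow>
      m' e = pos i + min (Suc j) (length (Fs ! i)) \<Longrightarrow>
      m' 5 = 0 \<longleftrightarrow> pad d (Fs ! i) ! j = Some (m x) \<Longrightarrow>
      (\<And>r. r \<notin> {e, s, 4, 5} \<Longrightarrow> m' r = m r) \<Longrightarrow> Q out m'"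
  shows "W (probe e s x) Q out m"
proof -
  have m0: "m 0 = 1" using assms(1) by (simp add: good_def)
  have e0: "e \<noteq> 0" "s \<noteq> 0" using regs by auto
  show ?thesis unfolding probe_def
  proof (rule wp_IfNZ)
    assume "m s \<noteq> 0"
    then have j: "j < length (Fs ! i)" using assms(3) by auto
    note rd = read_element[OF assms(2) j]
    have ne: "e \<noteq> s" "e \<noteq> 4" "e \<noteq> 5" "s \<noteq> 4" "s \<noteq> 5" "x \<noteq> e" "x \<noteq> s" "x \<noteq> 4" "x \<noteq> 5"
      using regs by auto
    define v where "v = Fs ! i ! j"
    define m1 where "m1 = m(e := Suc (pos i + j), s := length (Fs ! i) - Suc j, 4 := v)"
    have Q: "Q out (m1(5 := c))" if "c = 0 \<longleftrightarrow> v = m x" for c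
    proof (rule cont)
      show "good (m1(5 := c))" using assms(1) regs by (simp add: m1_def)
      show "(m1(5 := c)) s = length (Fs ! i) - Suc j" using ne by (simp add: m1_def)
      show "(m1(5 := c)) e = pos i + min (Suc j) (length (Fs ! i))" using ne j by (simp add: m1_def)
      show "((m1(5 := c)) 5 = 0) = (pad d (Fs ! i) ! j = Some (m x))"
        using that j \<open>j < d\<close> by (simp add: nth_pad v_def)
      show "(m1(5 := c)) r = m r" if "r \<notin> {e, s, 4, 5}" for r using that by (simp add: m1_def)
    qed
    have x: "m1 x = m x" "m1 4 = v" using ne by (simp_all add: m1_def)
    have "W (sub 5 4 x ;; IfNZ 5 skip (sub 5 x 4)) Q out m1"
    proof (intro wp_Seq wp_Sub wp_IfNZ wp_skip)
      show "good (m1(5 := m1 4 - m1 x))" using assms(1) regs by (simp add: m1_def)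
      show "Q out (m1(5 := m1 4 - m1 x))" if "(m1(5 := m1 4 - m1 x)) 5 \<noteq> 0"
        using that x by (intro Q) auto
      show "Q out (m1(5 := m1 4 - m1 x, 5 := (m1(5 := m1 4 - m1 x)) x - (m1(5 := m1 4 - m1 x)) 4))"
        if "(m1(5 := m1 4 - m1 x)) 5 = 0"
        using that x ne unfolding fun_upd_upd by (intro Q) auto
    qed
    then show "W (inc e ;; dec s ;; read 4 e ;; sub 5 4 x ;; IfNZ 5 skip (sub 5 x 4)) Q out m"
      using assms(3,4) ne rd m0 e0 j v_def unfolding m1_def
      by (intro wp_Seq[of _ _ "inc e"] wp_Seq[of _ _ "dec s"] wp_Seq[of _ _ "read 4 e"]
          wp_Add wp_Sub wp_Read) simp
  next
    assume "m s = 0"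
    then have j: "\<not> j < length (Fs ! i)" using assms(3) by auto
    show "W (set_const 5 1) Q out m"
      by (intro wp_simple; rule cont)
        (use assms(1-4,10) regs j in \<open>auto simp: nth_pad\<close>)
  qed
qed

lemma wp_member:
  assumes "good m" "i < length Fs" "m a = pos i" "8 \<le> a"
    and cont: "\<And>m'. good m' \<Longrightarrow> m' 7 = (if m 6 \<in> set (Fs ! i) then 1 else 0) \<Longrightarrow>
      (\<And>r. r \<notin> {2, 3, 4, 5, 7} \<Longrightarrow> m' r = m r) \<Longrightarrow> Q out m'"
  shows "W (member d a) Q out m"
proof -
  let ?X = "Fs ! i"
  let ?P = "probe 3 2 6 ;; IfNZ 5 skip (set_const 7 1)"
  let ?I = "\<lambda>j (o1 :: nat list) m1. m1 2 = length ?X - j \<and> m1 3 = pos i + min j (length ?X) \<and>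
      m1 7 = (if Some (m 6) \<in> set (take j (pad d ?X)) then 1 else (0 :: nat))"
  define m1 where "m1 = m(3 := pos i, 2 := length ?X, 7 := 0)"
  have m1: "good m1" using assms(1) by (simp add: m1_def)
  have "W (seqs (replicate d ?P)) Q out m1"
  proof (rule wp_seqs[where I = ?I])
    fix j o2 m2
    assume j: "j < length (replicate d ?P)" and I: "?I j o2 m2"
      and F: "frame (seqs (replicate d ?P)) out m1 o2 m2"
    have 6: "m2 6 = m 6" using frame_eq[OF F, of 6] by (auto simp: m1_def probe_def)
    have jd: "j < d" "j < length (pad d ?X)" using j small_nth[OF assms(2)] by (auto simp: length_pad)
    have "W ?P (?I (Suc j)) o2 m2"
    proof (intro wp_Seq, rule wp_probe[OF frame_good[OF F] assms(2), where j = j])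
      fix m3
      assume A: "good m3" "m3 2 = length (Fs ! i) - Suc j" "m3 3 = pos i + min (Suc j) (length (Fs ! i))"
        "(m3 5 = 0) = (pad d (Fs ! i) ! j = Some (m2 6))"
        and "\<And>r. r \<notin> {3, 2, 4, 5} \<Longrightarrow> m3 r = m2 r"
      then have "m3 7 = m2 7" by simp
      then have 7: "m3 7 = (if Some (m 6) \<in> set (take j (pad d ?X)) then 1 else 0)" using I by simp
      have "set (take (Suc j) (pad d ?X)) = insert (pad d ?X ! j) (set (take j (pad d ?X)))"
        using jd by (simp add: take_Suc_conv_app_nth)
      then show "W (IfNZ 5 skip (set_const 7 1)) (?I (Suc j)) o2 m3"
        using A 6 7 by (intro wp_IfNZ wp_simple) simp_all
    qed (use I jd in simp_all)
    then show "W (replicate d ?P ! j) (?I (Suc j)) o2 m2" using jd by simp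
  next
    fix o2 m2
    assume I: "?I (length (replicate d ?P)) o2 m2"
      and F: "frame (seqs (replicate d ?P)) out m1 o2 m2"
    have "o2 = out" using silentD[OF _ F] by simp
    moreover have "m2 r = m r" if "r \<notin> {2, 3, 4, 5, 7}" for r
      using frame_eq[OF F, of r] that by (auto simp: m1_def probe_def)
    moreover have "m2 7 = (if m 6 \<in> set ?X then 1 else 0)"
      using I small_nth[OF assms(2)] by (simp add: length_pad Some_in_pad)
    ultimately show "Q o2 m2" using cont frame_good[OF F] by blast
  qed (use m1 in \<open>auto simp: m1_def\<close>)
  then show ?thesis unfolding member_def
    by (intro wp_simple)
      (use assms(1-4) read_size[OF assms(2)] in \<open>simp add: m1_def good_def\<close>)
qed

end

lemma take_Suc_ball: "j < length xs \<Longrightarrow> (\<forall>x \<in> set (take (Suc j) xs). P x) \<longleftrightarrow> (\<forall>x \<in> set (take j xs). P x) \<and> P (xs ! j)"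
  by (auto simp: take_Suc_conv_app_nth)

lemma wp_add_power:
  assumes "good m" "m 10 = q" "q \<le> N" and regs: "2 \<le> r" "r \<noteq> 10" "\<And>i. r \<noteq> reg i 5"
    and cont: "\<And>m'. good m' \<Longrightarrow> m' r = m r + q ^ j \<Longrightarrow>
      (\<And>r'. r' \<notin> writes (add_power j r) \<Longrightarrow> m' r' = m r') \<Longrightarrow> Q out m'"
  shows "wp N w (add_power j r) Q out m"
  using assms(1,2) cont
proof (induction j arbitrary: m Q out)
  case 0
  then show ?case using regs by (auto intro!: wp_Add simp: good_def)
next
  case (Suc j)
  let ?c = "reg j 5"
  let ?B = "add_power j r ;; dec ?c"
  let ?I = "\<lambda>n (o1 :: nat list) m1. m1 ?c = q - n \<and> m1 r = m r + n * q ^ j"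
  define m1 where "m1 = m(?c := q)"
  have wr: "10 \<notin> writes ?B" "?c \<notin> writes (add_power j r)"
    using writes_add_power[of 10 j r] writes_add_power[of ?c j r] regs regs(3)[of j] by auto
  have "wp N w (WhileNZ ?c ?B) Q out m1"
  proof (rule wp_While[where I = ?I and K = q])
    fix n o2 m2
    assume n: "n < q" and I: "?I n o2 m2" and F: "frame ?B out m1 o2 m2"
    have "m2 10 = q" using frame_eq[OF F wr(1)] Suc.prems(2) by (simp add: m1_def)
    then have "wp N w (add_power j r) (wp N w (dec ?c) (?I (Suc n))) o2 m2"
    proof (rule Suc.IH[OF frame_good[OF F]])
      fix m3
      assume A: "good m3" "m3 r = m2 r + q ^ j"
        and "\<And>r'. r' \<notin> writes (add_power j r) \<Longrightarrow> m3 r' = m2 r'"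
      then have "m3 ?c = m2 ?c" using wr(2) by blast
      then show "wp N w (dec ?c) (?I (Suc n)) o2 m3"
        using A I n regs(3)[of j] by (intro wp_Sub) (simp add: good_def)
    qed
    then show "m2 ?c \<noteq> 0 \<and> wp N w ?B (?I (Suc n)) o2 m2" using I n by (simp add: wp_Seq)
  next
    fix o2 m2
    assume I: "?I q o2 m2" and F: "frame ?B out m1 o2 m2"
    have "o2 = out" using silentD[OF _ F] by simp
    moreover have "m2 r' = m r'" if "r' \<notin> writes (add_power (Suc j) r)" for r'
      using frame_eq[OF F, of r'] that by (simp add: m1_def)
    ultimately show "m2 ?c = 0 \<and> Q o2 m2" using Suc.prems(3)[OF frame_good[OF F]] I by simp
  qed (use assms(3) Suc.prems(1) regs regs(3)[of j] in \<open>auto simp: m1_def\<close>)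
  then show ?case using Suc.prems(1,2)
    by (simp del: One_nat_def) (intro wp_Seq wp_Sub; simp add: m1_def good_def)
qed

context hs_input begin

lemma wp_contains_nth:
  assumes "good m" "i < length Fs" "i' < length Fs" "m a = pos i" "m b = pos i'"
    and regs: "8 \<le> a" "8 \<le> b" "8 \<le> z" "z \<noteq> a" "z \<noteq> b"
    and cont: "\<And>m'. good m' \<Longrightarrow>
      m' z = (if j < length (Fs ! i) \<and> Fs ! i ! j \<in> set (Fs ! i') then m z else 0) \<Longrightarrow>
      (\<And>r. r \<notin> {2, 3, 4, 5, 6, 7, z} \<Longrightarrow> m' r = m r) \<Longrightarrow> Q out m'"
  shows "W (contains_nth d a b z j) Q out m"
proof -
  let ?X = "Fs ! i"
  let ?P = "dec 2 ;; inc 3"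
  let ?I = "\<lambda>c (o1 :: nat list) m1. m1 2 = length ?X - c \<and> m1 3 = pos i + c"
  let ?last = "IfNZ 7 skip (set_const z 0)"
  let ?rest = "set_const 7 0 ;; IfNZ 2 (inc 3 ;; read 6 3 ;; member d b) skip ;; ?last"
  have last: "W ?last Q out m2"
    if "good m2" "m2 7 = (if j < length ?X \<and> ?X ! j \<in> set (Fs ! i') then 1 else 0)"
      and eq: "\<And>r. r \<notin> {2, 3, 4, 5, 6, 7} \<Longrightarrow> m2 r = m r" for m2
  proof -
    have "m2 z = m z" using eq[of z] regs by auto
    then show ?thesis using that regs by (intro wp_IfNZ wp_skip wp_Const cont) (auto split: if_splits)
  qed
  have rest: "W ?rest Q out m2"
    if m2: "good m2" "m2 2 = length ?X - j" "m2 3 = pos i + j"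
      and eq: "\<And>r. r \<notin> {2, 3} \<Longrightarrow> m2 r = m r" for m2
  proof (rule wp_Seq, rule wp_Const, rule wp_Seq, rule wp_IfNZ)
    assume "(m2(7 := 0)) 2 \<noteq> 0"
    then have j: "j < length ?X" using m2 by simp
    note rd = read_element[OF assms(2) j]
    define m3 where "m3 = m2(7 := 0, 3 := Suc (pos i + j), 6 := ?X ! j)"
    have "W (member d b) (W ?last Q) out m3"
    proof (rule wp_member[OF _ assms(3)])
      show "good m3" using m2 by (simp add: m3_def)
      show "m3 b = pos i'" using eq[of b] regs assms(5) by (simp add: m3_def)
      fix m4
      assume "good m4" "m4 7 = (if m3 6 \<in> set (Fs ! i') then 1 else 0)"
        and eq4: "\<And>r. r \<notin> {2, 3, 4, 5, 7} \<Longrightarrow> m4 r = m3 r"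
      then show "W ?last Q out m4"
        by (intro last) (use j eq in \<open>auto simp: m3_def\<close>)
    qed (use regs in auto)
    then show "W (inc 3 ;; read 6 3 ;; member d b) (W ?last Q) out (m2(7 := 0))"
      using m2 rd by (intro wp_Seq wp_Add wp_Read) (simp add: m3_def good_def)
  next
    assume "(m2(7 := 0)) 2 = 0"
    then have j: "\<not> j < length ?X" using m2 by simp
    then show "W skip (W ?last Q) out (m2(7 := 0))"
      by (intro wp_skip last) (use m2 eq in auto)
  qed
  define m1 where "m1 = m(3 := pos i, 2 := length ?X)"
  have "W (seqs (replicate j ?P)) (W ?rest Q) out m1"
  proof (rule wp_seqs[where I = ?I])
    fix c o2 m2
    assume c: "c < length (replicate j ?P)" and I: "?I c o2 m2"
      and F: "frame (seqs (replicate j ?P)) out m1 o2 m2"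
    have "m2 0 = 1" using frame_good[OF F] by (auto simp: good_def)
    then show "W (replicate j ?P ! c) (?I (Suc c)) o2 m2"
      using c I by (auto intro!: wp_simple)
  next
    fix o2 m2
    assume I: "?I (length (replicate j ?P)) o2 m2"
      and F: "frame (seqs (replicate j ?P)) out m1 o2 m2"
    have "o2 = out" using silentD[OF _ F] by simp
    moreover have "m2 r = m r" if "r \<notin> {2, 3}" for r
      using frame_eq[OF F, of r] that by (auto simp: m1_def)
    ultimately show "W ?rest Q o2 m2" using rest I frame_good[OF F] by simp
  qed (use assms(1) in \<open>auto simp: m1_def\<close>)
  then show ?thesis unfolding contains_nth_def
    by (intro wp_Seq wp_Sub wp_Read)
      (use assms(1,4) regs read_size[OF assms(2)] in \<open>simp add: m1_def good_def\<close>)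
qed

text \<open>An index beyond the end of \<open>Fs ! i\<close> makes it false. Index lists that
  describe no subset of the tested set thus count no sets and impose no condition.\<close>

definition embeds :: "nat list \<Rightarrow> nat \<Rightarrow> nat \<Rightarrow> bool" where
  "embeds js i i' \<longleftrightarrow> (\<forall>j \<in> set js. j < length (Fs ! i) \<and> Fs ! i ! j \<in> set (Fs ! i'))"

lemma wp_contains:
  assumes "good m" "i < length Fs" "i' < length Fs" "m a = pos i" "m b = pos i'"
    and regs: "8 \<le> a" "8 \<le> b" "8 \<le> z" "z \<noteq> a" "z \<noteq> b"
    and cont: "\<And>m'. good m' \<Longrightarrow> m' z = (if embeds js i i' then 1 else 0) \<Longrightarrow>
      (\<And>r. r \<notin> {2, 3, 4, 5, 6, 7, z} \<Longrightarrow> m' r = m r) \<Longrightarrow> Q out m'"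
  shows "W (contains d js a b z) Q out m"
proof -
  let ?Ps = "map (contains_nth d a b z) js"
  let ?ok = "\<lambda>j. j < length (Fs ! i) \<and> Fs ! i ! j \<in> set (Fs ! i')"
  let ?I = "\<lambda>c (o1 :: nat list) m1. m1 z = (if \<forall>j \<in> set (take c js). ?ok j then 1 else (0 :: nat))"
  have wr: "r \<notin> writes (seqs ?Ps)" if "r \<notin> {2, 3, 4, 5, 6, 7, z}" for r
    using that writes_basic(4) by fastforce
  have "W (seqs ?Ps) Q out (m(z := 1))"
  proof (rule wp_seqs[where I = ?I])
    fix c o2 m2
    assume c: "c < length ?Ps" and I: "?I c o2 m2" and F: "frame (seqs ?Ps) out (m(z := 1)) o2 m2"
    have "m2 a = pos i" "m2 b = pos i'"
      using frame_eq[OF F wr, of a] frame_eq[OF F wr, of b] regs assms(4,5) by auto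
    then have "W (contains_nth d a b z (js ! c)) (?I (Suc c)) o2 m2"
    proof (rule wp_contains_nth[OF frame_good[OF F] assms(2,3) _ _ regs])
      fix m3 assume "m3 z = (if ?ok (js ! c) then m2 z else 0)"
      then show "?I (Suc c) o2 m3" using I c by (auto simp: take_Suc_ball)
    qed
    then show "W (?Ps ! c) (?I (Suc c)) o2 m2" using c by simp
  next
    fix o2 m2
    assume I: "?I (length ?Ps) o2 m2" and F: "frame (seqs ?Ps) out (m(z := 1)) o2 m2"
    have "o2 = out" using silentD[OF _ F] by simp
    moreover have "m2 r = m r" if "r \<notin> {2, 3, 4, 5, 6, 7, z}" for r
      using frame_eq[OF F wr[OF that]] that by simp
    ultimately show "Q o2 m2" using cont[OF frame_good[OF F]] I by (simp add: embeds_def)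
  qed (use assms(1) regs in auto)
  then show ?thesis unfolding contains_def by (intro wp_Seq wp_Const)
qed

end

section \<open>The nested survival test\<close>

context hs_input begin

text \<open>Since \<open>Fs ! i\<close> has no repetitions, its subsets of size
  \<open>d - Suc l\<close> correspond to the index lists of that length below
  \<open>length (Fs ! i)\<close>. The remaining lists are harmless: their count is \<open>0\<close>,
  and \<open>0 < q\<close> makes the threshold positive.\<close>

lemma survives_Suc_iff:
  assumes "i < length Fs" "0 < q"
  shows "survives d q Fs (Suc l) i \<longleftrightarrow> survives d q Fs l i \<and>
    (\<forall>js \<in> set (index_lists d (d - Suc l)).
      card {i'. i' < i \<and> survives d q Fs l i' \<and> embeds js i i'} < q ^ Suc l)"
    (is "_ \<longleftrightarrow> _ \<and> ?R")
proof -
  let ?X = "Fs ! i"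
  have X: "distinct ?X" "length ?X \<le> d" using assms(1) dist small by auto
  have "(\<forall>C \<subseteq> set ?X. card C = d - Suc l \<longrightarrow>
      card {i'. i' < i \<and> survives d q Fs l i' \<and> C \<subseteq> set (Fs ! i')} < q ^ Suc l) \<longleftrightarrow> ?R"
    (is "?L \<longleftrightarrow> _")
  proof
    assume L: ?L
    show ?R
    proof
      fix js assume "js \<in> set (index_lists d (d - Suc l))"
      then have js: "js \<in> set (subseqs [0..<d])" "length js = d - Suc l"
        by (auto simp: index_lists_def)
      show "card {i'. i' < i \<and> survives d q Fs l i' \<and> embeds js i i'} < q ^ Suc l"
      proof (cases "\<forall>j \<in> set js. j < length ?X")
        case True
        let ?C = "(!) ?X ` set js"
        have "distinct js" using js subseqs_distinctD by fastforce
        moreover have "inj_on ((!) ?X) (set js)"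
          using True X(1) by (auto simp: inj_on_def nth_eq_iff_index_eq)
        ultimately have "card ?C = d - Suc l" using js(2) by (simp add: card_image distinct_card)
        moreover have "?C \<subseteq> set ?X" using True by auto
        moreover have "embeds js i i' \<longleftrightarrow> ?C \<subseteq> set (Fs ! i')" for i'
          using True by (auto simp: embeds_def)
        ultimately show ?thesis using L by simp
      next
        case False
        then have "\<not> embeds js i i'" for i' by (auto simp: embeds_def)
        then show ?thesis using assms(2) by simp
      qed
    qed
  next
    assume R: ?R
    show ?L
    proof (intro allI impI)
      fix C assume C: "C \<subseteq> set ?X" "card C = d - Suc l"
      let ?J = "{j. j < length ?X \<and> ?X ! j \<in> C}"
      have im: "(!) ?X ` ?J = C" using C(1) by (force simp: in_set_conv_nth)
      have "inj_on ((!) ?X) ?J" using X(1) by (auto simp: inj_on_def nth_eq_iff_index_eq)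
      then have cJ: "card ?J = d - Suc l" using card_image im C(2) by fastforce
      have "?J \<in> Pow (set [0..<d])" using X(2) by auto
      \<comment> \<open>The indices of the elements of \<open>C\<close>, in increasing order, form
        one of the precomputed lists.\<close>
      then obtain js where js: "js \<in> set (subseqs [0..<d])" "set js = ?J"
        unfolding subseqs_powset[symmetric] by (metis (lifting) imageE)
      have "distinct js" using js(1) subseqs_distinctD by fastforce
      then have "length js = d - Suc l" using js(2) cJ distinct_card by metis
      then have "js \<in> set (index_lists d (d - Suc l))" using js(1) by (simp add: index_lists_def)
      moreover have "embeds js i i' \<longleftrightarrow> C \<subseteq> set (Fs ! i')" for i'
      proof -
        have "embeds js i i' \<longleftrightarrow> (\<forall>x \<in> (!) ?X ` ?J. x \<in> set (Fs ! i'))"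
          unfolding embeds_def js(2) by auto
        then show ?thesis unfolding im by blast
      qed
      ultimately show "card {i'. i' < i \<and> survives d q Fs l i' \<and> C \<subseteq> set (Fs ! i')} < q ^ Suc l"
        using R by auto
    qed
  qed
  then show ?thesis by simp
qed

lemma card_less_Suc:
  "card {i'. i' < Suc i \<and> P i'} = card {i'. i' < i \<and> P i'} + (if P i then 1 else 0)"
proof -
  have "{i'. i' < Suc i \<and> P i'} = {i'. i' < i \<and> P i'} \<union> (if P i then {i} else {})"
    by (auto simp: less_Suc_eq)
  then show ?thesis by simp
qed

text \<open>The specification of level \<open>l\<close> in continuation form, for all memories,
  positions and postconditions. As a named predicate it becomes the induction hypothesis that
  \<open>wp_threshold_check\<close> applies to every earlier set.\<close>

definition tests :: "nat \<Rightarrow> nat \<Rightarrow> bool" where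
  "tests q l \<longleftrightarrow> (\<forall>m Q out i. good m \<longrightarrow> m 10 = q \<longrightarrow> m (reg l 0) = pos i \<longrightarrow> i < length Fs \<longrightarrow>
    (\<forall>m'. good m' \<longrightarrow> m' (reg l 1) = (if survives d q Fs l i then 1 else 0) \<longrightarrow>
      (\<forall>r. r \<notin> writes (survival_test d l) \<longrightarrow> m' r = m r) \<longrightarrow> Q out m') \<longrightarrow>
    W (survival_test d l) Q out m)"

lemma testsD:
  assumes "tests q l" "good m" "m 10 = q" "m (reg l 0) = pos i" "i < length Fs"
    and "\<And>m'. good m' \<Longrightarrow> m' (reg l 1) = (if survives d q Fs l i then 1 else 0) \<Longrightarrow>
      (\<And>r. r \<notin> writes (survival_test d l) \<Longrightarrow> m' r = m r) \<Longrightarrow> Q out m'"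
  shows "W (survival_test d l) Q out m"
  using assms unfolding tests_def by blast

lemma wp_threshold_check:
  fixes q l i :: nat and js :: "nat list"
  assumes T: "tests q l" and m: "good m" "m 10 = q" "m (reg (Suc l) 0) = pos i"
    and i: "i < length Fs" and q: "q \<le> N"
  defines "A \<equiv> \<lambda>n. card {i'. i' < n \<and> survives d q Fs l i' \<and> embeds js i i'}"
  shows "W (threshold_check d l (survival_test d l) js)
    (\<lambda>o' m'. m' (reg (Suc l) 1) = (if A i < q ^ Suc l then m (reg (Suc l) 1) else 0)) out m"
proof -
  let ?a = "reg (Suc l) 0" and ?b = "reg (Suc l) 1" and ?c = "reg (Suc l) 2"
    and ?f = "reg (Suc l) 3" and ?z = "reg (Suc l) 4" and ?a' = "reg l 0" and ?b' = "reg l 1"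
  let ?Q = "\<lambda>(o' :: nat list) m'. m' ?b = (if A i < q ^ Suc l then m ?b else 0)"
  let ?last = "IfNZ ?c skip (set_const ?b 0)"
  let ?upd = "sub ?f ?a ?a'"
  let ?step = "advance d ?a' ;; ?upd"
  let ?B = "contains d js ?a ?a' ?z ;; IfNZ ?z (survival_test d l ;; IfNZ ?b' (dec ?c) skip) skip ;; ?step"
  \<comment> \<open>\<open>A n\<close> counts the witnesses among the first \<open>n\<close> sets.
    Truncated subtraction keeps the second equation true when the countdown has reached
    \<open>0\<close> and further witnesses appear.\<close>
  let ?I = "\<lambda>n (o1 :: nat list) m1. m1 ?a' = pos n \<and> m1 ?c = q ^ Suc l - A n \<and> m1 ?f = pos i - pos n"
  have notest: "?a \<notin> writes (survival_test d l)" "?b \<notin> writes (survival_test d l)"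
    "?c \<notin> writes (survival_test d l)" "?z \<notin> writes (survival_test d l)"
    "?a' \<notin> writes (survival_test d l)" "10 \<notin> writes (survival_test d l)"
    using writes_survival_test[of _ d l] by (force simp: reg_def)+
  have noadv: "r \<notin> writes (advance d ?a')" if "r \<noteq> 2" "r \<noteq> ?a'" for r
    using writes_basic(1)[of ?a' r d] that by auto
  have nocont: "r \<notin> writes (contains d js ?a ?a' ?z)" if "r \<notin> {2, 3, 4, 5, 6, 7, ?z}" for r
    using writes_basic(5) that by blast
  have wr: "10 \<notin> writes ?B" "?a \<notin> writes ?B" "?b \<notin> writes ?B"
    using notest by (auto simp: noadv nocont)
  have step: "W ?step (?I (Suc n)) o2 m2"
    if m2: "good m2" "m2 ?a' = pos n" "m2 ?a = pos i" "m2 ?c = q ^ Suc l - A (Suc n)" and n: "n < i"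
    for o2 m2 n
  proof (rule wp_Seq, rule wp_advance[OF m2(1,2)])
    fix m3
    assume A: "good m3" "m3 ?a' = pos (Suc n)" "\<And>r. r \<noteq> ?a' \<Longrightarrow> r \<noteq> 2 \<Longrightarrow> m3 r = m2 r"
    then have "m3 ?a = pos i" "m3 ?c = q ^ Suc l - A (Suc n)" using m2 by auto
    then show "W ?upd (?I (Suc n)) o2 m3" using A(2) by (intro wp_Sub) simp
  qed (use n i in auto)
  have loop: "W (WhileNZ ?f ?B) (W ?last ?Q) out m1"
    if m1: "good m1" "?I 0 out m1" "m1 10 = q" "m1 ?a = pos i" "m1 ?b = m ?b" for m1
  proof (rule wp_While[where I = ?I and K = i])
    fix n o2 m2
    assume n: "n < i" and I: "?I n o2 m2" and F: "frame ?B out m1 o2 m2"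
    have n': "n < length Fs" using n i by simp
    have e2: "m2 10 = q" "m2 ?a = pos i" using frame_eq[OF F wr(1)] frame_eq[OF F wr(2)] m1 by auto
    have "W (contains d js ?a ?a' ?z) (W (IfNZ ?z (survival_test d l ;; IfNZ ?b' (dec ?c) skip) skip ;; ?step) (?I (Suc n))) o2 m2"
    proof (rule wp_contains[OF frame_good[OF F] i n' e2(2)])
      fix m3
      assume m3: "good m3" "m3 ?z = (if embeds js i n then 1 else 0)"
        and eq3: "\<And>r. r \<notin> {2, 3, 4, 5, 6, 7, ?z} \<Longrightarrow> m3 r = m2 r"
      have e3: "m3 10 = q" "m3 ?a = pos i" "m3 ?a' = pos n" "m3 ?c = q ^ Suc l - A n"
        using eq3 e2 I by auto
      show "W (IfNZ ?z (survival_test d l ;; IfNZ ?b' (dec ?c) skip) skip ;; ?step) (?I (Suc n)) o2 m3"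
      proof (rule wp_Seq, rule wp_IfNZ)
        assume "m3 ?z \<noteq> 0"
        then have emb: "embeds js i n" using m3(2) by (auto split: if_splits)
        show "W (survival_test d l ;; IfNZ ?b' (dec ?c) skip) (W ?step (?I (Suc n))) o2 m3"
        proof (rule wp_Seq, rule testsD[OF T m3(1) e3(1,3) n'])
          fix m4
          assume m4: "good m4" "m4 ?b' = (if survives d q Fs l n then 1 else 0)"
            and eq4: "\<And>r. r \<notin> writes (survival_test d l) \<Longrightarrow> m4 r = m3 r"
          have e4: "m4 ?a = pos i" "m4 ?a' = pos n" "m4 ?c = q ^ Suc l - A n" "m4 0 = 1"
            using eq4 notest e3 m4(1) by (auto simp: good_def)
          show "W (IfNZ ?b' (dec ?c) skip) (W ?step (?I (Suc n))) o2 m4"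
            using m4 e4 emb n
            by (intro wp_IfNZ wp_skip wp_Sub step) (auto simp: A_def card_less_Suc split: if_splits)
        qed
      next
        assume "m3 ?z = 0"
        then have "\<not> embeds js i n" using m3(2) by (auto split: if_splits)
        then show "W skip (W ?step (?I (Suc n))) o2 m3"
          using m3 e3 n by (intro wp_skip step) (auto simp: A_def card_less_Suc)
      qed
    qed (use I in auto)
    \<comment> \<open>The guard \<open>pos i - pos n\<close> is positive as long as
      \<open>n < i\<close>: every set occupies at least its size word, so positions strictly
      increase.\<close>
    moreover have "m2 ?f \<noteq> 0" using I pos_mono[OF n] i by simp
    ultimately show "m2 ?f \<noteq> 0 \<and> W ?B (?I (Suc n)) o2 m2" by (simp add: wp_Seq)
  next
    fix o2 m2
    assume I: "?I i o2 m2" and F: "frame ?B out m1 o2 m2"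
    have "m2 ?b = m ?b" using frame_eq[OF F wr(3)] m1 by simp
    then show "m2 ?f = 0 \<and> W ?last ?Q o2 m2"
      using I frame_good[OF F] by (auto intro!: wp_IfNZ wp_skip wp_Const)
  qed (use m1 i N in auto)
  have "W (add_power (Suc l) ?c) (W (set_const ?a' 3 ;; ?upd ;; WhileNZ ?f ?B ;; ?last) ?Q) out (m(?c := 0))"
  proof (rule wp_add_power[OF _ _ q])
    fix m1
    assume m1: "good m1" "m1 ?c = (m(?c := 0)) ?c + q ^ Suc l"
      and eq: "\<And>r. r \<notin> writes (add_power (Suc l) ?c) \<Longrightarrow> m1 r = (m(?c := 0)) r"
    have np: "r \<notin> writes (add_power (Suc l) ?c)" if "r \<noteq> ?c" "\<And>i. r \<noteq> reg i 5" for r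
      using writes_add_power that by blast
    have "m1 10 = q" "m1 ?a = pos i" "m1 ?b = m ?b"
      using eq[OF np] m by auto
    then show "W (set_const ?a' 3 ;; ?upd ;; WhileNZ ?f ?B ;; ?last) ?Q out m1"
      using m1 by (intro wp_Seq wp_Const wp_Sub loop) (auto simp: A_def)
  qed (use m in auto)
  then show ?thesis unfolding threshold_check_def
    by (intro wp_Seq wp_Const)
qed

lemma tests_survival_test:
  assumes q: "q \<le> N" "0 < q"
  shows "tests q l"
proof (induction l)
  case 0
  show ?case unfolding tests_def by (auto intro!: wp_Const)
next
  case (Suc l)
  show ?case unfolding tests_def
  proof (intro allI impI)
    fix m Q i and out :: "nat list"
    let ?a = "reg (Suc l) 0" and ?b = "reg (Suc l) 1" and ?a' = "reg l 0" and ?b' = "reg l 1"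
    let ?T = "survival_test d l"
    let ?js = "index_lists d (d - Suc l)"
    let ?Ps = "map (threshold_check d l ?T) ?js"
    assume m: "good m" "m 10 = q" "m ?a = pos i" and i: "i < length Fs"
      and cont: "\<forall>m'. good m' \<longrightarrow> m' ?b = (if survives d q Fs (Suc l) i then 1 else 0) \<longrightarrow>
        (\<forall>r. r \<notin> writes (survival_test d (Suc l)) \<longrightarrow> m' r = m r) \<longrightarrow> Q out m'"
    let ?light = "\<lambda>js. card {i'. i' < i \<and> survives d q Fs l i' \<and> embeds js i i'} < q ^ Suc l"
    let ?Q = "\<lambda>(o' :: nat list) m'. m' ?b = (if survives d q Fs (Suc l) i then 1 else (0 :: nat))"
    let ?I = "\<lambda>n (o1 :: nat list) m1.
      m1 ?b = (if survives d q Fs l i \<and> (\<forall>js \<in> set (take n ?js). ?light js) then 1 else (0 :: nat))"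
    have nw: "10 \<notin> writes (survival_test d (Suc l))" "?a \<notin> writes (survival_test d (Suc l))"
      using writes_survival_test[of _ d "Suc l"] by force+
    have seqs: "W (seqs ?Ps) ?Q out m1"
      if m1: "good m1" "m1 10 = q" "m1 ?a = pos i" "?I 0 out m1" for m1
    proof (rule wp_seqs[where I = ?I])
      fix n o2 m2
      assume n: "n < length ?Ps" and I: "?I n o2 m2" and F: "frame (seqs ?Ps) out m1 o2 m2"
      have "m2 10 = q" "m2 ?a = pos i"
        using frame_eq[OF F, of 10] frame_eq[OF F, of ?a] nw m1 by auto
      from wp_threshold_check[OF Suc.IH frame_good[OF F] this i q(1)]
      have "W (threshold_check d l ?T (?js ! n)) (?I (Suc n)) o2 m2"
        by (rule wp_mono) (use I n in \<open>auto simp: take_Suc_ball\<close>)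
      then show "W (?Ps ! n) (?I (Suc n)) o2 m2" using n by simp
    next
      fix o2 m2 assume "?I (length ?Ps) o2 m2"
      then show "?Q o2 m2" using survives_Suc_iff[OF i q(2)] by (simp del: survives.simps)
    qed (use m1 in auto)
    have "W (survival_test d (Suc l)) ?Q out m"
      unfolding survival_test.simps
    proof (rule wp_Seq, rule wp_Sub, rule wp_Seq, rule testsD[OF Suc.IH _ _ _ i])
      fix m1
      assume m1: "good m1" "m1 ?b' = (if survives d q Fs l i then 1 else 0)"
        and eq: "\<And>r. r \<notin> writes ?T \<Longrightarrow> m1 r = (m(?a' := m ?a - m 1)) r"
      have "10 \<notin> writes ?T" "?a \<notin> writes ?T" using nw by auto
      then have "m1 10 = q" "m1 ?a = pos i" using eq m by auto
      then show "W (copy ?b ?b' ;; seqs ?Ps) ?Q out m1"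
        using m1 by (intro wp_Seq wp_Sub seqs) (auto simp: good_def)
    qed (use m in \<open>auto simp: good_def\<close>)
    \<comment> \<open>So far only the answer register was tracked; the unchanged registers and the
      silence are read off the program text.\<close>
    then show "W (survival_test d (Suc l)) Q out m"
    proof (rule wp_frame)
      fix o2 m2
      assume "?Q o2 m2" and F: "frame (survival_test d (Suc l)) out m o2 m2"
      moreover have "o2 = out" using silentD[OF _ F] by simp
      ultimately show "Q o2 m2" using cont frame_good[OF F] frame_eq[OF F] by blast
    qed (use m in simp_all)
  qed
qed

lemmas wp_survival_test = testsD[OF tests_survival_test]

end

lemma not_writes_survival_test: "8 \<le> r \<Longrightarrow> r \<le> 20 \<Longrightarrow> r \<notin> writes (survival_test d l)"
  "reg l 0 \<notin> writes (survival_test d l)"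
  using writes_survival_test by fastforce+

lemma not_writes_advance: "2 \<le> a \<Longrightarrow> r \<noteq> a \<Longrightarrow> r \<noteq> 2 \<Longrightarrow> r \<notin> writes (advance d a)"
  using writes_basic(1) by blast

lemma not_writes_probe: "2 \<le> e \<Longrightarrow> 2 \<le> s \<Longrightarrow> r \<notin> {e, s, 4, 5} \<Longrightarrow> r \<notin> writes (probe e s x)"
  using writes_basic(2) by blast

lemmas not_writes = not_writes_survival_test not_writes_advance not_writes_probe

section \<open>Scans over the survivors: counting, labelling, writing\<close>

locale hs_run = hs_input +
  fixes q :: nat
  assumes q: "q \<le> N" "0 < q"
begin

abbreviation "n \<equiv> length Fs"
abbreviation "alive \<equiv> survives d q Fs d"

definition kept :: "nat \<Rightarrow> nat list list" where
  "kept i = map ((!) Fs) (filter alive [0..<i])"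

lemma kept_0 [simp]: "kept 0 = []"
  by (simp add: kept_def)

lemma kept_Suc [simp]: "kept (Suc i) = kept i @ (if alive i then [Fs ! i] else [])"
  by (simp add: kept_def)

lemma kept_all: "kept n = survivors d q Fs"
  by (simp add: kept_def survivors_def)

lemma wp_count_survivors:
  assumes m: "good m" "m 9 = n" "m 10 = q"
  shows "W (count_survivors d) (\<lambda>o' m'. m' 11 = length (kept n) \<and> m' 12 = d * length (kept n)) out m"
proof -
  let ?a = "reg d 0" and ?b = "reg d 1"
  let ?step = "advance d ?a ;; dec 13"
  let ?add = "seqs (replicate d (inc 12))"
  let ?B = "survival_test d d ;; IfNZ ?b (inc 11 ;; ?add) skip ;; ?step"
  let ?I = "\<lambda>i (o1 :: nat list) m1. m1 ?a = pos i \<and> m1 13 = n - i \<and> m1 11 = length (kept i) \<and>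
      m1 12 = d * length (kept i)"
  let ?Q = "\<lambda>(o' :: nat list) m'. m' 11 = length (kept n) \<and> m' 12 = d * length (kept n)"
  have wr: "10 \<notin> writes ?B"
    by (auto simp: not_writes)
  have step: "W ?step (?I (Suc i)) o2 m2"
    if m2: "good m2" "m2 ?a = pos i" "m2 13 = n - i" "m2 11 = length (kept (Suc i))"
      "m2 12 = d * length (kept (Suc i))" and i: "i < n" for o2 m2 i
  proof (rule wp_Seq, rule wp_advance[OF m2(1,2) i])
    fix m3
    assume A: "good m3" "m3 ?a = pos (Suc i)" "\<And>r. r \<noteq> ?a \<Longrightarrow> r \<noteq> 2 \<Longrightarrow> m3 r = m2 r"
    have "m3 13 = n - i" "m3 11 = length (kept (Suc i))" "m3 12 = d * length (kept (Suc i))"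
      using A(3)[of 13] A(3)[of 11] A(3)[of 12] m2 by auto
    then show "W (dec 13) (?I (Suc i)) o2 m3" using A(1,2) by (intro wp_Sub) (simp add: good_def)
  qed simp
  \<comment> \<open>On entry register \<open>11\<close> already counts the new survivor, while
    register \<open>12\<close> still lags behind by \<open>d\<close>.\<close>
  have add: "W ?add (W ?step (?I (Suc i))) o2 m2"
    if m2: "good m2" "m2 ?a = pos i" "m2 13 = n - i" "m2 11 = length (kept (Suc i))"
      "m2 12 + d = d * length (kept (Suc i))" and i: "i < n" for o2 m2 i
  proof (rule wp_seqs[where I = "\<lambda>c o3 m3. m3 12 = m2 12 + c"])
    fix c o3 m3
    assume c: "c < length (replicate d (inc 12))" and I: "m3 12 = m2 12 + c" and F: "frame ?add o2 m2 o3 m3"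
    show "W (replicate d (inc 12) ! c) (\<lambda>o3 m3. m3 12 = m2 12 + Suc c) o3 m3"
      using c I frame_good[OF F] by (auto intro!: wp_Add simp: good_def)
  next
    fix o3 m3
    assume I: "m3 12 = m2 12 + length (replicate d (inc 12))" and F: "frame ?add o2 m2 o3 m3"
    have "m3 r = m2 r" if "r \<noteq> 12" for r using frame_eq[OF F, of r] that by auto
    then show "W ?step (?I (Suc i)) o3 m3"
      using I m2 i frame_good[OF F] by (intro step) auto
  qed (use m2 in auto)
  have loop: "W (WhileNZ 13 ?B) ?Q out m1"
    if m1: "good m1" "m1 10 = q" "?I 0 out m1" for m1
  proof (rule wp_While[where I = ?I and K = n])
    fix i o2 m2
    assume i: "i < n" and I: "?I i o2 m2" and F: "frame ?B out m1 o2 m2"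
    have "m2 10 = q" "m2 ?a = pos i" using frame_eq[OF F wr] m1 I by auto
    then have "W (survival_test d d) (W (IfNZ ?b (inc 11 ;; ?add) skip ;; ?step) (?I (Suc i))) o2 m2"
    proof (rule wp_survival_test[OF q frame_good[OF F] _ _ i])
      fix m3
      assume m3: "good m3" "m3 ?b = (if alive i then 1 else 0)"
        and eq: "\<And>r. r \<notin> writes (survival_test d d) \<Longrightarrow> m3 r = m2 r"
      have "m3 ?a = pos i" "m3 13 = n - i" "m3 11 = length (kept i)" "m3 12 = d * length (kept i)" "m3 0 = 1"
        using eq[of ?a] eq[of 13] eq[of 11] eq[of 12] I m3(1) by (auto simp: not_writes good_def)
      then show "W (IfNZ ?b (inc 11 ;; ?add) skip ;; ?step) (?I (Suc i)) o2 m3"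
        using m3 i
        by (intro wp_Seq[of _ _ "IfNZ ?b (inc 11 ;; ?add) skip"] wp_Seq[of _ _ "inc 11"] wp_IfNZ wp_Add wp_skip add step)
          (auto split: if_splits)
    qed
    then show "m2 13 \<noteq> 0 \<and> W ?B (?I (Suc i)) o2 m2" using I i by (simp add: wp_Seq)
  qed (use m1 N in auto)
  show ?thesis unfolding count_survivors_def
    by (intro wp_Seq wp_Const wp_Sub loop) (use m in \<open>auto simp: good_def\<close>)
qed

abbreviation "lab \<equiv> label d (survivors d q Fs)"

lemma wp_find_label:
  assumes m: "good m" "m 9 = n" "m 10 = q"
  shows "W (find_label d) (\<lambda>o' m'. m' 18 = lab (m 17)) out m"
proof -
  let ?a = "reg d 0" and ?b = "reg d 1"
  let ?step = "advance d ?a ;; dec 20"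
  let ?P = "probe 3 2 17 ;; IfNZ 5 (IfNZ 19 (inc 18) skip) (set_const 19 0)"
  let ?scan = "seqs (replicate d ?P)"
  let ?B = "survival_test d d ;; IfNZ ?b (copy 3 ?a ;; read 2 ?a ;; ?scan) skip ;; ?step"
  define x where "x = m 17"
  define L where "L i = concat (map (pad d) (kept i))" for i
  let ?J = "\<lambda>xs m1. m1 18 = first_index (Some x) xs \<and> m1 19 = (if Some x \<in> set xs then 0 else 1 :: nat)"
  let ?I = "\<lambda>i (o1 :: nat list) m1. m1 ?a = pos i \<and> m1 20 = n - i \<and> ?J (L i) m1"
  let ?Q = "\<lambda>(o' :: nat list) m'. m' 18 = lab x"
  have wr: "10 \<notin> writes ?B" "17 \<notin> writes ?B"
    by (auto simp: not_writes)
  have step: "W ?step (?I (Suc i)) o2 m2"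
    if m2: "good m2" "m2 ?a = pos i" "m2 20 = n - i" "?J (L (Suc i)) m2" and i: "i < n" for o2 m2 i
  proof (rule wp_Seq, rule wp_advance[OF m2(1,2) i])
    fix m3
    assume A: "good m3" "m3 ?a = pos (Suc i)" "\<And>r. r \<noteq> ?a \<Longrightarrow> r \<noteq> 2 \<Longrightarrow> m3 r = m2 r"
    have "m3 20 = n - i" "?J (L (Suc i)) m3"
      using A(3)[of 20] A(3)[of 18] A(3)[of 19] m2 by auto
    then show "W (dec 20) (?I (Suc i)) o2 m3" using A(1,2) by (intro wp_Sub) (simp add: good_def)
  qed simp
  have scan: "W ?scan (W ?step (?I (Suc i))) o2 m2"
    if m2: "good m2" "m2 ?a = pos i" "m2 20 = n - i" "?J (L i) m2" "m2 17 = x"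
      "m2 3 = pos i" "m2 2 = length (Fs ! i)" and i: "i < n" "alive i" for o2 m2 i
  proof -
    let ?X = "Fs ! i"
    let ?K = "\<lambda>j (o1 :: nat list) m1. m1 2 = length ?X - j \<and> m1 3 = pos i + min j (length ?X) \<and>
      ?J (L i @ take j (pad d ?X)) m1"
    show ?thesis
    proof (rule wp_seqs[where I = ?K])
      fix j o3 m3
      assume j: "j < length (replicate d ?P)" and I: "?K j o3 m3" and F: "frame ?scan o2 m2 o3 m3"
      have x3: "m3 17 = x" using frame_eq[OF F, of 17] m2 by (auto simp: not_writes)
      have jd: "j < d" "j < length (pad d ?X)" using j small_nth[OF i(1)] by (auto simp: length_pad)
      have "W ?P (?K (Suc j)) o3 m3"
      proof (rule wp_Seq, rule wp_probe[OF frame_good[OF F] i(1), where j = j])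
        fix m4
        assume A: "good m4" "m4 2 = length ?X - Suc j" "m4 3 = pos i + min (Suc j) (length ?X)"
          "(m4 5 = 0) = (pad d ?X ! j = Some (m3 17))"
          and eq: "\<And>r. r \<notin> {3, 2, 4, 5} \<Longrightarrow> m4 r = m3 r"
        have J: "?J (L i @ take j (pad d ?X)) m4" "m4 0 = 1" using eq[of 18] eq[of 19] I A(1) by (auto simp: good_def)
        define xs where "xs = L i @ take j (pad d ?X)"
        have t: "L i @ take (Suc j) (pad d ?X) = xs @ [pad d ?X ! j]"
          using jd by (simp add: take_Suc_conv_app_nth xs_def)
        show "W (IfNZ 5 (IfNZ 19 (inc 18) skip) (set_const 19 0)) (?K (Suc j)) o3 m4"
          unfolding t using A J[folded xs_def] x3
          by (intro wp_IfNZ wp_Add wp_skip wp_Const) (auto simp: first_index_snoc split: if_splits)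
      qed (use I jd in simp_all)
      then show "W (replicate d ?P ! j) (?K (Suc j)) o3 m3" using jd by simp
    next
      fix o3 m3
      assume I: "?K (length (replicate d ?P)) o3 m3" and F: "frame ?scan o2 m2 o3 m3"
      have "L (Suc i) = L i @ pad d ?X" using i by (simp add: L_def)
      then have "?J (L (Suc i)) m3" using I small_nth[OF i(1)] by (simp add: length_pad)
      moreover have "m3 ?a = m2 ?a" "m3 20 = m2 20"
        using frame_eq[OF F, of ?a] frame_eq[OF F, of 20] by (auto simp: not_writes)
      ultimately show "W ?step (?I (Suc i)) o3 m3"
        using m2 i frame_good[OF F] by (intro step) auto
    qed (use m2 in auto)
  qed
  have loop: "W (WhileNZ 20 ?B) ?Q out m1"
    if m1: "good m1" "m1 10 = q" "m1 17 = x" "?I 0 out m1" for m1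
  proof (rule wp_While[where I = ?I and K = n])
    fix i o2 m2
    assume i: "i < n" and I: "?I i o2 m2" and F: "frame ?B out m1 o2 m2"
    have m2: "m2 10 = q" "m2 ?a = pos i" "m2 17 = x"
      using frame_eq[OF F wr(1)] frame_eq[OF F wr(2)] m1 I by auto
    have "W (survival_test d d) (W (IfNZ ?b (copy 3 ?a ;; read 2 ?a ;; ?scan) skip ;; ?step) (?I (Suc i))) o2 m2"
    proof (rule wp_survival_test[OF q frame_good[OF F] m2(1,2) i])
      fix m3
      assume m3: "good m3" "m3 ?b = (if alive i then 1 else 0)"
        and eq: "\<And>r. r \<notin> writes (survival_test d d) \<Longrightarrow> m3 r = m2 r"
      have e3: "m3 ?a = pos i" "m3 20 = n - i" "?J (L i) m3" "m3 17 = x" "m3 1 = 0"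
        using eq[of ?a] eq[of 20] eq[of 18] eq[of 19] eq[of 17] I m3(1) m2
        by (auto simp: not_writes good_def)
      show "W (IfNZ ?b (copy 3 ?a ;; read 2 ?a ;; ?scan) skip ;; ?step) (?I (Suc i)) o2 m3"
      proof (rule wp_Seq, rule wp_IfNZ)
        assume "m3 ?b \<noteq> 0"
        then have "alive i" using m3 by (auto split: if_splits)
        then show "W (copy 3 ?a ;; read 2 ?a ;; ?scan) (W ?step (?I (Suc i))) o2 m3"
          using m3(1) e3 i read_size[OF i] by (intro wp_Seq[of _ _ "copy 3 ?a"] wp_Seq[of _ _ "read 2 ?a"]
              wp_Sub wp_Read scan) auto
      next
        assume "m3 ?b = 0"
        then have "\<not> alive i" using m3 by (auto split: if_splits)
        then have "L (Suc i) = L i" by (simp add: L_def)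
        then show "W skip (W ?step (?I (Suc i))) o2 m3"
          using m3(1) e3 i by (intro wp_skip step) auto
      qed
    qed
    then show "m2 20 \<noteq> 0 \<and> W ?B (?I (Suc i)) o2 m2" using I i by (simp add: wp_Seq)
  next
    fix o2 m2 assume "?I n o2 m2"
    then show "m2 20 = 0 \<and> ?Q o2 m2" by (simp add: L_def kept_all label_def)
  qed (use m1 N in auto)
  show ?thesis unfolding find_label_def x_def[symmetric]
    by (intro wp_Seq wp_Const wp_Sub loop) (use m in \<open>auto simp: good_def x_def L_def first_index_def\<close>)
qed

lemma not_writes_find_label: "8 \<le> r \<Longrightarrow> r \<le> 17 \<Longrightarrow> r \<notin> writes (find_label d)"
  by (auto simp: find_label_def not_writes)

lemma not_writes_write_set: "8 \<le> r \<Longrightarrow> r \<le> 14 \<Longrightarrow> r \<notin> writes (write_set d)"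
  by (auto simp: write_set_def not_writes_find_label)

lemma wp_write_set:
  assumes m: "good m" "m 9 = n" "m 10 = q" "m 14 = pos i" and i: "i < n"
  shows "W (write_set d) (\<lambda>o' m'. o' = out @ length (Fs ! i) # map lab (Fs ! i)) out m"
proof -
  let ?X = "Fs ! i"
  let ?P = "IfNZ 15 (inc 16 ;; dec 15 ;; read 17 16 ;; find_label d ;; emit 18) skip"
  let ?I = "\<lambda>j (o1 :: nat list) m1. o1 = out @ length ?X # map lab (take j ?X) \<and>
    m1 15 = length ?X - j \<and> m1 16 = pos i + min j (length ?X)"
  have loop: "W (seqs (replicate d ?P)) (\<lambda>o' m'. o' = out @ length ?X # map lab ?X) (out @ [length ?X]) m1"
    if m1: "good m1" "m1 9 = n" "m1 10 = q" "?I 0 (out @ [length ?X]) m1" for m1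
  proof (rule wp_seqs[where I = ?I])
    fix j o2 m2
    assume j: "j < length (replicate d ?P)" and I: "?I j o2 m2"
      and F: "frame (seqs (replicate d ?P)) (out @ [length ?X]) m1 o2 m2"
    have m2: "m2 9 = n" "m2 10 = q" "m2 0 = 1"
      using frame_eq[OF F, of 9] frame_eq[OF F, of 10] m1 frame_good[OF F]
      by (auto simp: not_writes_find_label good_def)
    have "W ?P (?I (Suc j)) o2 m2"
    proof (rule wp_IfNZ)
      assume "m2 15 \<noteq> 0"
      then have jX: "j < length ?X" using I by auto
      note rd = read_element[OF i jX]
      define m3 where "m3 = m2(16 := Suc (pos i + j), 15 := length ?X - Suc j, 17 := ?X ! j)"
      have m3: "good m3" "m3 9 = n" "m3 10 = q" "m3 17 = ?X ! j"
        using m2 frame_good[OF F] by (auto simp: m3_def)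
      have "W (find_label d) (W (emit 18) (?I (Suc j))) o2 m3"
      proof (rule wp_frame[OF wp_find_label[OF m3(1-3)] _ m3(1)])
        fix o4 m4
        assume A: "m4 18 = lab (m3 17)" and F': "frame (find_label d) o2 m3 o4 m4"
        have "o4 = o2" using silentD[OF _ F'] by simp
        moreover have "m4 15 = length ?X - Suc j" "m4 16 = Suc (pos i + j)"
          using frame_eq[OF F', of 15] frame_eq[OF F', of 16] by (auto simp: not_writes_find_label m3_def)
        ultimately show "W (emit 18) (?I (Suc j)) o4 m4"
          using A I jX m3(4) by (intro wp_Write) (auto simp: take_Suc_conv_app_nth)
      qed simp
      then show "W (inc 16 ;; dec 15 ;; read 17 16 ;; find_label d ;; emit 18) (?I (Suc j)) o2 m2"
        using I jX rd m2(3) by (intro wp_Seq wp_Add wp_Sub wp_Read) (simp add: m3_def)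
    next
      assume "m2 15 = 0"
      then show "W skip (?I (Suc j)) o2 m2"
        using I by (intro wp_skip frame_good[OF F]) auto
    qed
    then show "W (replicate d ?P ! j) (?I (Suc j)) o2 m2" using j by simp
  next
    fix o2 m2 assume "?I (length (replicate d ?P)) o2 m2"
    then show "o2 = out @ length ?X # map lab ?X" using small_nth[OF i] by simp
  qed (use m1 in simp_all)
  have "W (seqs (replicate d ?P)) (\<lambda>o' m'. o' = out @ length ?X # map lab ?X) (out @ [length ?X])
      (m(15 := length ?X, 16 := pos i))"
    by (rule loop) (use m in simp_all)
  then show ?thesis unfolding write_set_def
    by (intro wp_Seq wp_Read wp_Write wp_Sub) (use m(1,4) read_size[OF i] in \<open>simp add: good_def\<close>)
qed

lemma wp_write_family:
  assumes m: "good m" "m 9 = n" "m 10 = q"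
  shows "W (write_family d)
    (\<lambda>o' m'. o' = out @ concat (map (\<lambda>X. length X # X) (map (map lab) (survivors d q Fs)))) out m"
proof -
  let ?a = "reg d 0" and ?b = "reg d 1"
  let ?step = "advance d 14 ;; dec 13"
  let ?B = "copy ?a 14 ;; survival_test d d ;; IfNZ ?b (write_set d) skip ;; ?step"
  define E where "E i = out @ concat (map (\<lambda>X. length X # X) (map (map lab) (kept i)))" for i
  let ?I = "\<lambda>i o1 m1. o1 = E i \<and> m1 14 = pos i \<and> m1 13 = n - i"
  let ?Q = "\<lambda>o' (m' :: mem). o' = E n"
  have wr: "10 \<notin> writes ?B" "9 \<notin> writes ?B"
    by (auto simp: not_writes not_writes_write_set)
  have step: "W ?step (?I (Suc i)) (E (Suc i)) m2"
    if m2: "good m2" "m2 14 = pos i" "m2 13 = n - i" and i: "i < n" for m2 i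
  proof (rule wp_Seq, rule wp_advance[OF m2(1,2) i])
    fix m3
    assume A: "good m3" "m3 14 = pos (Suc i)" "\<And>r. r \<noteq> 14 \<Longrightarrow> r \<noteq> 2 \<Longrightarrow> m3 r = m2 r"
    have "m3 13 = n - i" using A(3)[of 13] m2 by auto
    then show "W (dec 13) (?I (Suc i)) (E (Suc i)) m3" using A(1,2) by (intro wp_Sub) (simp add: good_def)
  qed simp
  have loop: "W (WhileNZ 13 ?B) ?Q out m1"
    if m1: "good m1" "m1 10 = q" "m1 9 = n" "?I 0 out m1" for m1
  proof (rule wp_While[where I = ?I and K = n])
    fix i o2 m2
    assume i: "i < n" and I: "?I i o2 m2" and F: "frame ?B out m1 o2 m2"
    define m2' where "m2' = m2(?a := pos i)"
    have m2: "good m2'" "m2' 10 = q" "m2' ?a = pos i" "m2' 9 = n" "m2' 13 = n - i" "m2' 14 = pos i"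
      using frame_eq[OF F wr(1)] frame_eq[OF F wr(2)] frame_good[OF F] m1 I by (auto simp: m2'_def)
    have "W (survival_test d d) (W (IfNZ ?b (write_set d) skip ;; ?step) (?I (Suc i))) (E i) m2'"
    proof (rule wp_survival_test[OF q m2(1-3) i])
      fix m3
      assume m3: "good m3" "m3 ?b = (if alive i then 1 else 0)"
        and eq: "\<And>r. r \<notin> writes (survival_test d d) \<Longrightarrow> m3 r = m2' r"
      have e3: "m3 14 = pos i" "m3 13 = n - i" "m3 10 = q" "m3 9 = n"
        using eq[of 14] eq[of 13] eq[of 10] eq[of 9] m2 by (auto simp: not_writes)
      show "W (IfNZ ?b (write_set d) skip ;; ?step) (?I (Suc i)) (E i) m3"
      proof (rule wp_Seq, rule wp_IfNZ)
        assume "m3 ?b \<noteq> 0"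
        then have "alive i" using m3 by (auto split: if_splits)
        then have E: "E (Suc i) = E i @ length (Fs ! i) # map lab (Fs ! i)" by (simp add: E_def)
        show "W (write_set d) (W ?step (?I (Suc i))) (E i) m3"
        proof (rule wp_frame[OF wp_write_set[OF m3(1) e3(4,3,1) i] _ m3(1)])
          fix o4 m4
          assume A: "o4 = E i @ length (Fs ! i) # map lab (Fs ! i)"
            and F': "frame (write_set d) (E i) m3 o4 m4"
          have "m4 14 = pos i" "m4 13 = n - i"
            using frame_eq[OF F', of 14] frame_eq[OF F', of 13] e3 by (auto simp: not_writes_write_set)
          then show "W ?step (?I (Suc i)) o4 m4"
            unfolding A E[symmetric] using i frame_good[OF F'] by (intro step) auto
        qed simp
      next
        assume "m3 ?b = 0"
        then have "\<not> alive i" using m3 by (auto split: if_splits)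
        then have E: "E i = E (Suc i)" by (simp add: E_def)
        show "W skip (W ?step (?I (Suc i))) (E i) m3"
          unfolding E using m3(1) e3 i by (intro wp_skip step) auto
      qed
    qed
    moreover have "m2(?a := m2 14 - m2 1) = m2'"
      using I frame_good[OF F] by (simp add: m2'_def good_def)
    ultimately have "W ?B (?I (Suc i)) (E i) m2"
      by (intro wp_Seq[of _ _ "copy ?a 14"] wp_Sub wp_Seq[of _ _ "survival_test d d"]) simp
    then show "m2 13 \<noteq> 0 \<and> W ?B (?I (Suc i)) o2 m2" using I i by simp
  qed (use m1 N in auto)
  have "W (WhileNZ 13 ?B) ?Q out (m(13 := n, 14 := 3))"
    by (rule loop) (use m in \<open>simp_all add: E_def\<close>)
  moreover have "m 9 - m 1 = n" using m(1,2) by (simp add: good_def)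
  ultimately have "W (write_family d) ?Q out m"
    unfolding write_family_def by (intro wp_Seq wp_Const wp_Sub) (simp only:)
  then show ?thesis by (simp only: E_def kept_all)
qed

end

text \<open>Only the threshold base is capped; the emitted parameter is the original
  \<open>k\<close>, so input and output are compared for hitting sets of the same size.\<close>

lemma (in hs_input) wp_kernel_prog:
  defines "q \<equiv> Suc (min k (length Fs))"
  shows "W (kernel_prog d)
    (\<lambda>o' m'. o' = encoding k (d * length (survivors d q Fs)) (kernel_family d q Fs)) [] (\<lambda>_. 0)"
proof -
  interpret hs_run d k u Fs w N q
    by unfold_locales (use N in \<open>auto simp: q_def\<close>)
  let ?K = "survivors d q Fs"
  let ?Q = "\<lambda>o' (m' :: mem). o' = encoding k (d * length ?K) (kernel_family d q Fs)"
  let ?rest = "emit 8 ;; emit 12 ;; emit 11 ;; write_family d"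
  have w0: "w ! 0 = k" "w ! 2 = n" "2 < length w" by (simp_all add: w encoding_def)
  have fam: "W (write_family d) ?Q [k, d * length ?K, length ?K] m" if "good m" "m 9 = n" "m 10 = q" for m
    by (rule wp_mono[OF wp_write_family[OF that]]) (simp add: encoding_def kernel_family_def)
  have "W (count_survivors d) (W ?rest ?Q) [] m1" if m1: "good m1" "m1 9 = n" "m1 10 = q" "m1 8 = k" for m1
  proof (rule wp_frame[OF wp_count_survivors[OF m1(1-3)] _ m1(1)])
    fix o2 m2
    assume A: "m2 11 = length (kept n) \<and> m2 12 = d * length (kept n)"
      and F: "frame (count_survivors d) [] m1 o2 m2"
    have "o2 = []" using silentD[OF _ F] by (simp add: count_survivors_def)
    moreover have "m2 9 = n" "m2 10 = q" "m2 8 = k"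
      using frame_eq[OF F, of 9] frame_eq[OF F, of 10] frame_eq[OF F, of 8] m1
      by (auto simp: count_survivors_def not_writes)
    ultimately show "W ?rest ?Q o2 m2"
      using A frame_good[OF F] fam by (auto intro!: wp_Seq wp_Write simp: kept_all)
  qed (auto simp: count_survivors_def)
  then have "W (count_survivors d) (W ?rest ?Q) [] ((\<lambda>_. 0)(0 := 1, 8 := k, 9 := n, 10 := q))"
    by (simp add: good_def)
  moreover have "Suc (k - (k - n)) = q" by (simp add: q_def)
  ultimately have "W (sub 10 8 9 ;; sub 10 8 10 ;; inc 10 ;; count_survivors d ;; ?rest) ?Q []
      ((\<lambda>_. 0)(0 := 1, 8 := k, 9 := n))"
    by (intro wp_Seq[of _ _ "sub _ _ _"] wp_Seq[of _ _ "inc _"] wp_Seq[of _ _ "count_survivors d"]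
        wp_Sub wp_Add) simp
  moreover have "0 < length w" using w0(3) by linarith
  ultimately show ?thesis unfolding kernel_prog_def
    by (intro wp_Seq[of _ _ "set_const _ _"] wp_Seq[of _ _ "read _ _"] wp_Const wp_Read)
      (simp add: w0)
qed

section \<open>The kernelization\<close>

text \<open>Supplies the size bound required of a kernelization. \<open>add_power\<close> is reused
  with base \<open>k + 1\<close>, and \<open>c\<close> copies of it replace the
  multiplication.\<close>

lemma computable_power: "computable (\<lambda>k. c * Suc k ^ j)"
proof -
  let ?S = "seqs (replicate c (add_power j 11))"
  let ?P = "set_const 0 1 ;; read 10 1 ;; inc 10 ;; ?S ;; emit 11"
  have "\<exists>t s. runs ?P [k] t s [c * Suc k ^ j]" for k
  proof -
    let ?W = "wp (Suc k) [k]"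
    let ?I = "\<lambda>i (o1 :: nat list) m1. m1 11 = i * Suc k ^ j"
    let ?Q = "\<lambda>o' (m' :: mem). o' = [c * Suc k ^ j]"
    define m where "m = (\<lambda>_ :: nat. 0 :: nat)(0 := 1, 10 := Suc k)"
    have m: "good m" "m 10 = Suc k" "m 11 = 0" by (auto simp: m_def good_def)
    have nw: "10 \<notin> writes (add_power j 11)" using writes_add_power[of 10 j 11] by auto
    have "?W ?S (?W (emit 11) ?Q) [] m"
    proof (rule wp_seqs[where I = ?I])
      fix i o1 m1
      assume i: "i < length (replicate c (add_power j 11))" and I: "?I i o1 m1" and F: "frame ?S [] m o1 m1"
      have "m1 10 = Suc k" using frame_eq[OF F, of 10] nw m by auto
      then have "?W (add_power j 11) (?I (Suc i)) o1 m1"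
        by (rule wp_add_power[OF frame_good[OF F]]) (use I in simp_all)
      then show "?W (replicate c (add_power j 11) ! i) (?I (Suc i)) o1 m1" using i by simp
    next
      fix o1 m1
      assume "?I (length (replicate c (add_power j 11))) o1 m1" and F: "frame ?S [] m o1 m1"
      moreover have "o1 = []" using silentD[OF _ F] by simp
      ultimately show "?W (emit 11) ?Q o1 m1" by (intro wp_Write) simp
    qed (use m in auto)
    then have "?W ?P ?Q [] (\<lambda>_. 0)"
      by (intro wp_Seq wp_Const wp_Read wp_Add) (simp add: m_def)
    then show ?thesis unfolding wp_def runs_def by auto
  qed
  then show ?thesis unfolding computable_def by blast
qed

lemma writes_kernel_prog: "writes (kernel_prog d) \<subseteq> {..<reg (Suc d) 0}"
proof -
  have *: "writes (survival_test d d) \<subseteq> {..<reg (Suc d) 0}"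
    using writes_survival_test[of _ d d] by (fastforce simp: reg_def)
  have **: "writes (advance d a) \<subseteq> {..<reg (Suc d) 0}" "writes (probe 3 2 17) \<subseteq> {..<reg (Suc d) 0}"
    if "2 \<le> a" "a < reg (Suc d) 0" for a
    using writes_basic(1)[of a _ d] writes_basic(2)[of 3 2 _ 17] that by (fastforce simp: reg_def)+
  have r: "reg d 0 < reg (Suc d) 0" "\<And>v. v < 27 \<Longrightarrow> v < reg (Suc d) 0" by (auto simp: reg_def)
  have fl: "writes (find_label d) \<subseteq> {..<reg (Suc d) 0}"
    using * **[of "reg d 0"] r by (simp add: find_label_def UN_subset_iff)
  have cs: "writes (count_survivors d) \<subseteq> {..<reg (Suc d) 0}"
    using * **[of "reg d 0"] r by (simp add: count_survivors_def UN_subset_iff)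
  have ws: "writes (write_set d) \<subseteq> {..<reg (Suc d) 0}"
    using fl r by (simp add: write_set_def UN_subset_iff)
  have "writes (write_family d) \<subseteq> {..<reg (Suc d) 0}"
    using * **[of 14] ws r by (simp add: write_family_def)
  with cs r show ?thesis by (simp add: kernel_prog_def)
qed

text \<open>The numbering by \<open>us\<close> is injective and the listed sets are pairwise
  different, so nothing collapses between lists and family; sizes and counts can be computed on the
  lists.\<close>

lemma hs_encodesE:
  assumes "(U, F, k) \<in> instances (hitting_set d)" "encodes (hitting_set d) w (U, F, k)"
  obtains Fs where "w = encoding k (card U) Fs" "distinct (map set Fs)"
    "\<forall>X \<in> set Fs. distinct X \<and> length X \<le> d \<and> set X \<subseteq> {..<card U}"
    "card F = length Fs" "input_size (hitting_set d) (U, F, k) = card U + length Fs + sum_list (map length Fs)"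
    "has_hitting_set (U, F, k) \<longleftrightarrow> hittable k Fs"
proof -
  obtain us Fs where us: "distinct us" "set us = U"
    and Fs: "\<forall>X \<in> set Fs. distinct X \<and> set X \<subseteq> {..<length us}" "distinct (map set Fs)"
    and F: "F = (\<lambda>X. (!) us ` set X) ` set Fs"
    and w: "w = k # length us # length Fs # concat (map (\<lambda>X. length X # X) Fs)"
    using assms(2) by (auto simp: hitting_set_def hs_encodes_def)
  have u: "length us = card U" using us distinct_card by fastforce
  have inj: "inj_on ((!) us) {..<length us}" using us(1) by (simp add: inj_on_def nth_eq_iff_index_eq)
  have card: "card ((!) us ` set X) = length X" if "X \<in> set Fs" for X
    using Fs(1) that card_image[OF inj_on_subset[OF inj]] distinct_card by metis
  have injF: "inj_on (\<lambda>X. (!) us ` set X) (set Fs)"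
  proof (rule inj_onI)
    fix X Y assume XY: "X \<in> set Fs" "Y \<in> set Fs" "(!) us ` set X = (!) us ` set Y"
    then have "set X = set Y" using Fs(1) inj_on_image_eq_iff[OF inj] by metis
    then show "X = Y" using XY Fs(2) by (auto simp: distinct_map inj_on_def)
  qed
  have dFs: "distinct Fs" using Fs(2) by (simp add: distinct_map)
  have "(\<Sum>X \<in> F. card X) = (\<Sum>X \<in> set Fs. length X)"
    unfolding F sum.reindex[OF injF] by (simp add: card)
  also have "\<dots> = sum_list (map length Fs)" using dFs by (simp add: sum_list_distinct_conv_sum_set)
  finally have sum: "(\<Sum>X \<in> F. card X) = sum_list (map length Fs)" .
  have cF: "card F = length Fs" unfolding F card_image[OF injF] using dFs distinct_card by blast
  have "length X \<le> d" if "X \<in> set Fs" for X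
    using assms(1) card[OF that] that by (auto simp: hitting_set_def F)
  then show thesis
    using that[of Fs] w u Fs sum cF has_hitting_set_iff_hittable[OF us _ F] 
    by (simp add: encoding_def hitting_set_def)
qed

lemma encodes_encoding:
  assumes "distinct (map set Fs)" "\<forall>X \<in> set Fs. distinct X \<and> set X \<subseteq> {..<u}"
  shows "hs_encodes (encoding k u Fs) ({..<u}, set ` set Fs, k)"
    and "has_hitting_set ({..<u}, set ` set Fs, k) \<longleftrightarrow> hittable k Fs"
proof -
  have "(!) [0..<u] ` set X = set X" if "X \<in> set Fs" for X
    using assms(2) that by (force simp: image_iff)
  then have F: "set ` set Fs = (\<lambda>X. (!) [0..<u] ` set X) ` set Fs" by auto
  have X: "\<forall>X \<in> set Fs. set X \<subseteq> {..<length [0..<u]}" using assms(2) by simp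
  have U: "set [0..<u] = {..<u}" by auto
  show "has_hitting_set ({..<u}, set ` set Fs, k) \<longleftrightarrow> hittable k Fs"
    by (rule has_hitting_set_iff_hittable[OF _ U X F]) simp
  show "hs_encodes (encoding k u Fs) ({..<u}, set ` set Fs, k)"
    unfolding hs_encodes_def prod.case
    by (rule exI[of _ "[0..<u]"], rule exI[of _ Fs]) (use F assms U in \<open>simp add: encoding_def\<close>)
qed

text \<open>\<open>wp\<close> provides one run within the bounds, whereas the space bound and the
  final statement speak of every run.\<close>

lemma runs_deterministic:
  "runs P w t s out \<Longrightarrow> runs P w t' s' out' \<Longrightarrow> t' = t \<and> s' = s \<and> out' = out"
  unfolding runs_def using exec_deterministic by blast

lemma kernel_prog_run:
  assumes "(U, F, k) \<in> instances (hitting_set d)" "encodes (hitting_set d) w (U, F, k)"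
  obtains Fs m t s where
    "runs (kernel_prog d) w t s (encoding k (d * m) Fs)" "length Fs = m" "m \<le> (k + 1) ^ d"
    "t \<le> (size (kernel_prog d) + 1) * 3 ^ (d + 2) * max 1 (card F) ^ (d + 2)"
    "distinct (map set Fs)" "\<forall>X \<in> set Fs. distinct X \<and> length X \<le> d \<and> set X \<subseteq> {..<d * m}"
    "hittable k Fs \<longleftrightarrow> has_hitting_set (U, F, k)"
proof -
  obtain Fs where Fs: "w = encoding k (card U) Fs" "distinct (map set Fs)"
    "\<forall>X \<in> set Fs. distinct X \<and> length X \<le> d \<and> set X \<subseteq> {..<card U}"
    "card F = length Fs" "has_hitting_set (U, F, k) \<longleftrightarrow> hittable k Fs"
    using hs_encodesE[OF assms] by metis
  define N where "N = Suc (length Fs)"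
  define q where "q = Suc (min k (length Fs))"
  define m where "m = length (survivors d q Fs)"
  interpret hs_input d k "card U" Fs w N
    using Fs by unfold_locales (auto simp: N_def)
  obtain t s where run: "runs (kernel_prog d) w t s (encoding k (d * m) (kernel_family d q Fs))"
    and t: "t \<le> cost N (kernel_prog d)"
    using wp_kernel_prog unfolding wp_def runs_def q_def m_def by auto
  have qk: "k < q \<or> length Fs < q" by (auto simp: q_def)
  have "\<forall>X \<in> set Fs. distinct X \<and> length X \<le> d" using Fs(3) by blast
  note K = kernel_family_props[OF Fs(2) this qk m_def]
  have "q ^ d \<le> (k + 1) ^ d" by (intro power_mono) (auto simp: q_def)
  with K(2) have "m \<le> (k + 1) ^ d" by (rule le_trans)
  moreover have "cost N (kernel_prog d) \<le> (size (kernel_prog d) + 1) * (N + 1) ^ (d + 2)"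
    by (rule cost_le[OF loop_depth_kernel_prog])
  \<comment> \<open>\<open>N + 1\<close> is \<open>card F + 2\<close>, at most
    \<open>3 * max 1 (card F)\<close>; the maximum takes care of the empty family.\<close>
  moreover have "(N + 1) ^ (d + 2) \<le> (3 * max 1 (card F)) ^ (d + 2)"
    by (intro power_mono) (auto simp: N_def Fs(4))
  then have "(size (kernel_prog d) + 1) * (N + 1) ^ (d + 2) \<le>
      (size (kernel_prog d) + 1) * 3 ^ (d + 2) * max 1 (card F) ^ (d + 2)"
    unfolding power_mult_distrib mult.assoc by (rule mult_le_mono2)
  ultimately show thesis using that[OF run K(1)] t K(3-5) Fs(5) by (meson le_trans)
qed

lemma kernelization_kernel_prog: "kernelization (hitting_set d) (kernel_prog d)"
proof -
  define c where "c = (size (kernel_prog d) + 1) * 3 ^ (d + 2)"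
  \<comment> \<open>A universe of \<open>d * m\<close> elements, \<open>m\<close> sets, at most
    \<open>d * m\<close> memberships and the parameter give \<open>(2 * d + 1) * m + k\<close>. The
    exponent \<open>d + 1\<close> lets one more copy of the power absorb \<open>k\<close> even when
    \<open>d = 0\<close>.\<close>
  define g where "g k = (2 * d + 2) * Suc k ^ (d + 1)" for k
  have "\<exists>t s out. runs (kernel_prog d) w t s out \<and>
      t \<le> c * (input_size (hitting_set d) (U, F, k) + k) ^ (d + 2) + c \<and>
      (\<exists>I' \<in> instances (hitting_set d). encodes (hitting_set d) out I' \<and>
        (has_hitting_set (U, F, k) \<longleftrightarrow> I' \<in> yes_instances (hitting_set d)) \<and>
        input_size (hitting_set d) I' + parameter (hitting_set d) I' \<le> g k)"
    if I: "(U, F, k) \<in> instances (hitting_set d)" "encodes (hitting_set d) w (U, F, k)" for U F k w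
  proof -
    obtain Fs m t s where run: "runs (kernel_prog d) w t s (encoding k (d * m) Fs)"
      and m: "length Fs = m" "m \<le> (k + 1) ^ d" and t: "t \<le> c * max 1 (card F) ^ (d + 2)"
      and Fs: "distinct (map set Fs)" "\<forall>X \<in> set Fs. distinct X \<and> length X \<le> d \<and> set X \<subseteq> {..<d * m}"
      and hit: "hittable k Fs \<longleftrightarrow> has_hitting_set (U, F, k)"
      unfolding c_def by (rule kernel_prog_run[OF I])
    let ?I = "({..<d * m}, set ` set Fs, k)"
    let ?z = "input_size (hitting_set d) (U, F, k) + k"
    have "card F \<le> ?z" by (simp add: hitting_set_def)
    then have "max 1 (card F) ^ (d + 2) \<le> ?z ^ (d + 2) + 1"
      using power_mono[of "card F" ?z "d + 2"] by (cases "card F = 0") (simp_all add: max_def)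
    then have "c * max 1 (card F) ^ (d + 2) \<le> c * (?z ^ (d + 2) + 1)" by (rule mult_le_mono2)
    with t have "t \<le> c * ?z ^ (d + 2) + c" by simp
    moreover have small: "card Y \<le> d" if "Y \<in> set ` set Fs" for Y
      using Fs(2) that distinct_card by fastforce
    then have "?I \<in> instances (hitting_set d)" using Fs(2) by (auto simp: hitting_set_def)
    moreover have "encodes (hitting_set d) (encoding k (d * m) Fs) ?I"
      "has_hitting_set (U, F, k) \<longleftrightarrow> ?I \<in> yes_instances (hitting_set d)"
      using encodes_encoding[OF Fs(1), of "d * m" k] Fs(2) hit by (auto simp: hitting_set_def)
    moreover have "input_size (hitting_set d) ?I + parameter (hitting_set d) ?I \<le> g k"
    proof -
      have cm: "card (set ` set Fs) \<le> m" using m(1) by (metis card_length card_image_le finite_set le_trans)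
      have "(\<Sum>Y \<in> set ` set Fs. card Y) \<le> card (set ` set Fs) * d"
        using sum_bounded_above[of "set ` set Fs" card d] small by simp
      also have "\<dots> \<le> d * m" using cm by (simp add: mult.commute)
      finally have "input_size (hitting_set d) ?I + k \<le> (2 * d + 1) * m + k"
        using cm by (simp add: hitting_set_def)
      also have "\<dots> \<le> (2 * d + 1) * Suc k ^ d + k"
        using m(2) mult_le_mono2[of m "Suc k ^ d" "2 * d + 1"] by simp
      also have "\<dots> \<le> (2 * d + 1) * Suc k ^ (d + 1) + Suc k ^ (d + 1)"
      proof (intro add_mono mult_le_mono2)
        show "Suc k ^ d \<le> Suc k ^ (d + 1)" by (rule power_increasing) simp_all
        have "Suc k \<le> Suc k ^ (d + 1)" by (rule self_le_power) simp_all
        then show "k \<le> Suc k ^ (d + 1)" by simp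
      qed
      also have "\<dots> = g k" by (simp add: g_def)
      finally show ?thesis by (simp add: hitting_set_def)
    qed
    ultimately show ?thesis using run by blast
  qed
  moreover have "computable g" unfolding g_def by (rule computable_power)
  ultimately show ?thesis
    unfolding kernelization_def
    by (intro exI[of _ c] exI[of _ "d + 2"] exI[of _ g])
      (auto simp: hitting_set_def split: prod.splits)
qed

text \<open>A constant number of cells, each bounded by a polynomial in the input size because the
  running time is; passing to logarithms turns the exponent into a constant factor.\<close>

lemma space_kernel_prog:
  "\<exists>c::real. \<forall>U F k w t s out. (U, F, k) \<in> instances (hitting_set d) \<longrightarrow>
    encodes (hitting_set d) w (U, F, k) \<longrightarrow> runs (kernel_prog d) w t s out \<longrightarrow>
    real s \<le> c * log 2 (real (input_size (hitting_set d) (U, F, k) + k + 2))"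
proof -
  define c where "c = (size (kernel_prog d) + 1) * 3 ^ (d + 2)"
  define C where "C = d + 6 + c"
  define R where "R = reg (Suc d) 0"
  define c' where "c' = real R * (real (bits R) + log 2 (real C) + 1 + real (d + 2))"
  have "real s \<le> c' * log 2 (real (input_size (hitting_set d) (U, F, k) + k + 2))"
    if I: "(U, F, k) \<in> instances (hitting_set d)" "encodes (hitting_set d) w (U, F, k)"
      and run: "runs (kernel_prog d) w t s out" for U F k w t s out
  proof -
    obtain Fs where Fs: "w = encoding k (card U) Fs"
      "\<forall>X \<in> set Fs. distinct X \<and> length X \<le> d \<and> set X \<subseteq> {..<card U}" "card F = length Fs"
      and sz: "input_size (hitting_set d) (U, F, k) = card U + length Fs + sum_list (map length Fs)"
      by (rule hs_encodesE[OF I]) blast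
    define L where "L = input_size (hitting_set d) (U, F, k) + k + 2"
    have L: "2 \<le> L" "card F \<le> L" "k \<le> L" "card U \<le> L" "length Fs \<le> L"
      "length Fs + sum_list (map length Fs) \<le> L"
      unfolding L_def sz by (simp_all add: Fs(3))
    \<comment> \<open>Bounds the input length, where \<open>3\<close> is for the header, and every
      input word: size words by \<open>d\<close>, all others by \<open>L\<close>.\<close>
    let ?B = "L + d + 3"
    obtain t' s' out' where "runs (kernel_prog d) w t' s' out'" "t' \<le> c * max 1 (card F) ^ (d + 2)"
      unfolding c_def by (rule kernel_prog_run[OF I]) blast
    then have "t \<le> c * max 1 (card F) ^ (d + 2)" using runs_deterministic run by metis
    also have "\<dots> \<le> c * L ^ (d + 2)" using L by (intro mult_le_mono2 power_mono) auto
    finally have t: "t \<le> c * L ^ (d + 2)" .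
    have "length w = 3 + (length Fs + sum_list (map length Fs))"
      by (simp add: Fs(1) encoding_def length_concat comp_def sum_list_Suc)
    then have "length w \<le> ?B" using L by simp
    moreover have "\<forall>x \<in> set w. x \<le> ?B"
      using L Fs(2) by (fastforce simp: Fs(1) encoding_def)
    moreover obtain m' where "exec w (kernel_prog d) (\<lambda>_. 0) t s out m'" using run by (auto simp: runs_def)
    ultimately have "s \<le> R * (bits R + bits (?B + t))"
      using exec_bounded[OF _ tame_kernel_prog writes_kernel_prog, of w d "\<lambda>_. 0" t s out m' ?B]
      by (auto simp: R_def bounded_def)
    then have "real s \<le> real R * (real (bits R) + real (bits (?B + t)))"
      by (metis of_nat_add of_nat_le_iff of_nat_mult)
    also have "real (bits (?B + t)) \<le> log 2 (real (?B + t) + 1) + 1" by (rule bits_le_log)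
    also have "log 2 (real (?B + t) + 1) \<le> log 2 (real (C * L ^ (d + 2)))"
    proof -
      have "L \<le> L ^ (d + 2)" "1 \<le> L ^ (d + 2)" using L(1) by (simp_all add: self_le_power)
      then have "L + (d + 4) * 1 + c * L ^ (d + 2) \<le> L ^ (d + 2) + (d + 4) * L ^ (d + 2) + c * L ^ (d + 2)"
        by (intro add_mono mult_le_mono2) simp_all
      also have "\<dots> \<le> C * L ^ (d + 2)" by (simp add: C_def algebra_simps)
      finally have "?B + t + 1 \<le> C * L ^ (d + 2)" using t by simp
      then have "real (?B + t) + 1 \<le> real (C * L ^ (d + 2))" by linarith
      then show ?thesis by (subst log_le_cancel_iff) auto
    qed
    also have "log 2 (real (C * L ^ (d + 2))) = log 2 (real C) + real (d + 2) * log 2 (real L)"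
    proof -
      have "real C \<noteq> 0" "0 < real L" using L(1) by (auto simp: C_def)
      then show ?thesis unfolding of_nat_mult of_nat_power
        by (subst log_mult) (simp_all only: log_nat_power, auto)
    qed
    finally have "real s \<le> real R * (real (bits R) + (log 2 (real C) + real (d + 2) * log 2 (real L) + 1))"
      by (simp add: mult_left_mono)
    also have "\<dots> \<le> real R * ((real (bits R) + log 2 (real C) + 1 + real (d + 2)) * log 2 (real L))"
    proof (rule mult_left_mono)
      \<comment> \<open>The summand \<open>2\<close> in the space bound ensures
        \<open>2 \<le> L\<close>; additive constants are then swallowed by the factor
        \<open>log 2 (real L)\<close>.\<close>
      have lg: "1 \<le> log 2 (real L)" using L(1) by simp
      have "0 \<le> log 2 (real C)" by (simp add: C_def)
      then have "real (bits R) + log 2 (real C) + 1 \<le> (real (bits R) + log 2 (real C) + 1) * log 2 (real L)"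
        using lg mult_left_mono[OF lg, of "real (bits R) + log 2 (real C) + 1"] by simp
      then show "real (bits R) + (log 2 (real C) + real (d + 2) * log 2 (real L) + 1)
          \<le> (real (bits R) + log 2 (real C) + 1 + real (d + 2)) * log 2 (real L)"
        by (simp add: distrib_right)
    qed simp
    finally show ?thesis unfolding c'_def L_def by (simp add: mult.assoc)
  qed
  then show ?thesis by blast
qed

text \<open>The time bound has \<open>max 1 (card F)\<close> because even an empty family takes some
  steps. The bound on the number of sets is claimed for every instance that the output can be read
  as.\<close>

theorem theorem1:
  fixes d :: nat
  shows "\<exists>P. logspace_kernelization (hitting_set d) P \<and>
    (\<exists>c::nat. \<forall>U F k w t s out.
       (U, F, k) \<in> instances (hitting_set d) \<longrightarrow> encodes (hitting_set d) w (U, F, k) \<longrightarrow>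
       runs P w t s out \<longrightarrow> t \<le> c * max 1 (card F) ^ (d + 2)) \<and>
    (\<forall>U F k w t s out U' F' k'.
       (U, F, k) \<in> instances (hitting_set d) \<longrightarrow> encodes (hitting_set d) w (U, F, k) \<longrightarrow>
       runs P w t s out \<longrightarrow> encodes (hitting_set d) out (U', F', k') \<longrightarrow>
       card F' \<le> (k + 1) ^ d)"
proof (intro exI[of _ "kernel_prog d"] conjI allI impI)
  have "\<exists>c::real. \<forall>I \<in> instances (hitting_set d). \<forall>w t s out. encodes (hitting_set d) w I \<longrightarrow>
      runs (kernel_prog d) w t s out \<longrightarrow>
      real s \<le> c * log 2 (real (input_size (hitting_set d) I + parameter (hitting_set d) I + 2))"
  proof -
    obtain c :: real where c: "\<forall>U F k w t s out. (U, F, k) \<in> instances (hitting_set d) \<longrightarrow>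
      encodes (hitting_set d) w (U, F, k) \<longrightarrow> runs (kernel_prog d) w t s out \<longrightarrow>
      real s \<le> c * log 2 (real (input_size (hitting_set d) (U, F, k) + k + 2))"
      using space_kernel_prog by blast
    have par: "parameter (hitting_set d) (U, F, k) = k" for U F k by (simp add: hitting_set_def)
    show ?thesis
      by (rule exI[of _ c]) (use c in \<open>simp add: par split_paired_all\<close>)
  qed
  then show "logspace_kernelization (hitting_set d) (kernel_prog d)"
    unfolding logspace_kernelization_def using kernelization_kernel_prog by blast
  show "\<exists>c::nat. \<forall>U F k w t s out.
      (U, F, k) \<in> instances (hitting_set d) \<longrightarrow> encodes (hitting_set d) w (U, F, k) \<longrightarrow>
      runs (kernel_prog d) w t s out \<longrightarrow> t \<le> c * max 1 (card F) ^ (d + 2)"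
  proof (intro exI[of _ "(size (kernel_prog d) + 1) * 3 ^ (d + 2)"] allI impI)
    fix U F k w t s out
    assume I: "(U, F, k) \<in> instances (hitting_set d)" "encodes (hitting_set d) w (U, F, k)"
      and run: "runs (kernel_prog d) w t s out"
    obtain t' s' out' where "runs (kernel_prog d) w t' s' out'"
      "t' \<le> (size (kernel_prog d) + 1) * 3 ^ (d + 2) * max 1 (card F) ^ (d + 2)"
      by (rule kernel_prog_run[OF I])
    then show "t \<le> (size (kernel_prog d) + 1) * 3 ^ (d + 2) * max 1 (card F) ^ (d + 2)"
      using runs_deterministic[OF run] by simp
  qed
next
  fix U F k w t s out U' F' k'
  assume I: "(U, F, k) \<in> instances (hitting_set d)" "encodes (hitting_set d) w (U, F, k)"
    and run: "runs (kernel_prog d) w t s out" and out: "encodes (hitting_set d) out (U', F', k')"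
  obtain Fs m t' s' where "runs (kernel_prog d) w t' s' (encoding k (d * m) Fs)"
    and m: "length Fs = m" "m \<le> (k + 1) ^ d"
    by (rule kernel_prog_run[OF I])
  then have "out = encoding k (d * m) Fs" using runs_deterministic run by blast
  moreover obtain us Fs' where F': "F' = (\<lambda>X. (!) us ` set X) ` set Fs'"
    and "out = k' # length us # length Fs' # concat (map (\<lambda>X. length X # X) Fs')"
    using out by (auto simp: hitting_set_def hs_encodes_def)
  \<comment> \<open>The third output word is the number of listed sets, so every reading of the
    output has a list of the same length.\<close>
  ultimately have "length Fs' = m" using m(1) by (simp add: encoding_def)
  moreover have "card F' \<le> length Fs'"
    unfolding F' by (metis card_length card_image_le finite_set le_trans)
  ultimately show "card F' \<le> (k + 1) ^ d" using m(2) by simp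
qed

end
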